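(* Let $\mathcal{H}=\mathbb{C}^2$, let $\mathcal{A}'$ be an arbitrary finite collection of observables on $\mathbb{C}^2$, and let $p'\ge 2$. Then $$d_{\mathcal{A}',p'}(\rho,\omega)\le d_{\mathcal{A}',p'}(\rho,\tau)+d_{\mathcal{A}',p'}(\tau,\omega)$$ for every $\rho,\tau,\omega\in\mathcal{S}(\mathbb{C}^2)$.
   Context: For a Hilbert space $\mathcal{H}$, $\mathcal{S}(\mathcal{H})$ is the set of positive trace-class operators with unit trace (states); observables are self-adjoint operators. For an operator $A$ on $\mathcal{H}$, $A^T$ is the operator on the dual $\mathcal{H}^*$ given by $(A^T\eta)(\varphi)=\eta(A\varphi)$. Couplings: $\mathcal{C}(\rho,\omega)=\{\Pi\in\mathcal{S}(\mathcal{H}\otimes\mathcal{H}^* ): \mathrm{tr}_{\mathcal{H}^*}[\Pi]=\omega,\ \mathrm{tr}_{\mathcal{H}}[\Pi]=\rho^T\}$. For a finite collection $\mathcal{A}=\{A_1,\dots,A_K\}$ of observables and $0<p<\infty$, the cost operator is $C_{\mathcal{A},p}=\sum_{k=1}^K|A_k\otimes I^T-I\otimes A_k^T|^p$ on $\mathcal{H}\otimes\mathcal{H}^*$, the $p$-Wasserstein distance is $D_{\mathcal{A},p}(\rho,\omega)=\big(\inf_{\Pi\in\mathcal{C}(\rho,\omega)}\mathrm{tr}[\Pi C_{\mathcal{A},p}]\big)^{\min\{1/p,1\}}$, and the $p$-Wasserstein divergence is $$d_{\mathcal{A},p}(\rho,\omega)=\Big(D_{\mathcal{A},p}^{\max\{p,1\}}(\rho,\omega)-\tfrac12\big(D_{\mathcal{A},p}^{\max\{p,1\}}(\rho,\rho)+D_{\mathcal{A},p}^{\max\{p,1\}}(\omega,\omega)\big)\Big)^{\min\{1/p,1\}}.$$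 *)

theory Defs
  imports "HOL-Analysis.Analysis"
begin

text \<open>Finite-dimensional operators on C^'n are matrices complex^'n^'n (w.r.t. the standard basis).
  The dual space H* is identified with C^'n via the dual basis; then the operator A^T on H*
  is the (plain, non-conjugated) transpose matrix.  H (x) H* is C^('n x 'n) with the
  Kronecker product.\<close>

type_synonym 'n cmat = "complex^'n^'n"

definition mtrace :: "'n::finite cmat \<Rightarrow> complex" where
  "mtrace M = (\<Sum>i\<in>UNIV. M $ i $ i)"

definition madj :: "'n::finite cmat \<Rightarrow> 'n cmat" where
  "madj M = (\<chi> i j. cnj (M $ j $ i))"

definition mtransp :: "'n::finite cmat \<Rightarrow> 'n cmat" where
  "mtransp M = (\<chi> i j. M $ j $ i)"

definition self_adjoint :: "'n::finite cmat \<Rightarrow> bool" where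
  "self_adjoint M \<longleftrightarrow> madj M = M"

definition unitary_mat :: "'n::finite cmat \<Rightarrow> bool" where
  "unitary_mat U \<longleftrightarrow> U ** madj U = mat 1 \<and> madj U ** U = mat 1"

definition positive_op :: "'n::finite cmat \<Rightarrow> bool" where
  "positive_op M \<longleftrightarrow> (\<forall>v::complex^'n.
     let q = (\<Sum>i\<in>UNIV. \<Sum>j\<in>UNIV. cnj (v $ i) * M $ i $ j * v $ j)
     in Im q = 0 \<and> Re q \<ge> 0)"

definition states :: "'n::finite cmat set" where
  "states = {M. positive_op M \<and> mtrace M = 1}"

definition diag_mat :: "('n::finite \<Rightarrow> complex) \<Rightarrow> 'n cmat" where
  "diag_mat d = (\<chi> i j. if i = j then d i else 0)"

text \<open>Functional calculus |X|^p for a self-adjoint X via its spectral decomposition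
  X = U diag(d) U^* (U unitary, d real).  The result does not depend on the choice.\<close>
definition abs_pow :: "'n::finite cmat \<Rightarrow> real \<Rightarrow> 'n cmat" where
  "abs_pow X p = (SOME M. \<exists>U d. unitary_mat U \<and>
      X = U ** diag_mat (\<lambda>i. complex_of_real (d i)) ** madj U \<and>
      M = U ** diag_mat (\<lambda>i. complex_of_real (\<bar>d i\<bar> powr p)) ** madj U)"

text \<open>Kronecker-type operators on H (x) H*, index (i,j) with i for H and j for H*.\<close>
definition left_op :: "'n::finite cmat \<Rightarrow> ('n \<times> 'n) cmat" where
  "left_op A = (\<chi> x y. if snd x = snd y then A $ fst x $ fst y else 0)"

definition right_op :: "'n::finite cmat \<Rightarrow> ('n \<times> 'n) cmat" where
  "right_op B = (\<chi> x y. if fst x = fst y then B $ snd x $ snd y else 0)"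

definition ptrace_dual :: "('n::finite \<times> 'n) cmat \<Rightarrow> 'n cmat" where
  "ptrace_dual P = (\<chi> i k. \<Sum>j\<in>UNIV. P $ (i,j) $ (k,j))"

definition ptrace_H :: "('n::finite \<times> 'n) cmat \<Rightarrow> 'n cmat" where
  "ptrace_H P = (\<chi> j l. \<Sum>i\<in>UNIV. P $ (i,j) $ (i,l))"

definition couplings :: "'n::finite cmat \<Rightarrow> 'n cmat \<Rightarrow> ('n \<times> 'n) cmat set" where
  "couplings \<rho> \<omega> = {P. P \<in> states \<and> ptrace_dual P = \<omega> \<and> ptrace_H P = mtransp \<rho>}"

definition cost_op :: "'n::finite cmat list \<Rightarrow> real \<Rightarrow> ('n \<times> 'n) cmat" where
  "cost_op As p = (\<Sum>A\<leftarrow>As. abs_pow (left_op A - right_op (mtransp A)) p)"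

definition wdist :: "'n::finite cmat list \<Rightarrow> real \<Rightarrow> 'n cmat \<Rightarrow> 'n cmat \<Rightarrow> real" where
  "wdist As p \<rho> \<omega> =
     (Inf {Re (mtrace (P ** cost_op As p)) | P. P \<in> couplings \<rho> \<omega>}) powr (min (1/p) 1)"

definition wdiv :: "'n::finite cmat list \<Rightarrow> real \<Rightarrow> 'n cmat \<Rightarrow> 'n cmat \<Rightarrow> real" where
  "wdiv As p \<rho> \<omega> =
     (wdist As p \<rho> \<omega> powr (max p 1)
       - (wdist As p \<rho> \<rho> powr (max p 1) + wdist As p \<omega> \<omega> powr (max p 1)) / 2)
     powr (min (1/p) 1)"

end

(* For a qubit observable A the operator X = A (x) I - I (x) A^T has at most the eigenvalues
   0, c, -c, where c is the spectral gap of A.  Hence |X|^p = c^(p-2) X^2, and the cost of order p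
   is a quadratic cost for rescaled observables.  A coupling of rho and omega is a family of
   matrices X_k with sum X_k* X_k = rho and sum X_k X_k* = omega; up to terms that depend on
   the marginals only, its cost is -2 sum_k tr(X_k* A X_k A).  Couplings X of (rho, tau) and Y of
   (tau, omega) compose to Y_l tau^(-1/2) X_k, whose correlation term is an inner product <v, u> of
   a vector v given by X and a vector u given by Y.  The correlations of X and Y themselves are
   <v, a> and <a, u> with a given by tau.  The squared norms of v, a, u are correlations of
   self-couplings of rho, tau, omega, so the self-distances that enter the divergence bound them
   from above.  Thus the quadratic divergence obeys the triangle inequality of a Hilbert space,
   after enlarging v, a, u by mutually orthogonal components, and raising it to the power
   2/p <= 1 preserves the inequality. *)
theory Submission
  imports Defs
begin

section \<open>Traces, adjoints and positive operators\<close>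

lemma mtrace_add: "mtrace (M + N) = mtrace M + mtrace N"
  by (simp add: mtrace_def sum.distrib)

lemma mtrace_diff: "mtrace (M - N) = mtrace M - mtrace N"
  by (simp add: mtrace_def sum_subtractf)

lemma mtrace_sum: "mtrace (\<Sum>k\<in>K. f k) = (\<Sum>k\<in>K. mtrace (f k))"
  unfolding mtrace_def by (simp add: sum.swap[of _ K])

lemma mtrace_scaleR: "mtrace (c *\<^sub>R M) = of_real c * mtrace M"
  unfolding mtrace_def by (simp add: sum_distrib_left scaleR_conv_of_real[symmetric])

lemma mtrace_commute: "mtrace (M ** N) = mtrace (N ** M)"
  unfolding mtrace_def matrix_matrix_mult_def
  by (simp, subst sum.swap) (simp add: mult.commute)

lemma madj_mult: "madj (M ** N) = madj N ** madj M"
  by (simp add: madj_def matrix_matrix_mult_def vec_eq_iff mult.commute)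

lemma madj_madj [simp]: "madj (madj M) = M"
  by (simp add: madj_def vec_eq_iff)

lemma madj_diff: "madj (M - N) = madj M - madj N"
  by (simp add: madj_def vec_eq_iff)

lemma madj_sum: "madj (\<Sum>k\<in>K. f k) = (\<Sum>k\<in>K. madj (f k))"
  by (simp add: madj_def vec_eq_iff)

lemma madj_mat_1 [simp]: "madj (mat 1) = mat 1"
  by (simp add: madj_def vec_eq_iff mat_def)

lemma matrix_mult_sum_left: "(\<Sum>k\<in>K. f k) ** (N :: 'n::finite cmat) = (\<Sum>k\<in>K. f k ** N)"
  by (simp add: matrix_matrix_mult_def vec_eq_iff sum_distrib_right sum.swap[of _ K])

lemma matrix_mult_sum_right: "(N :: 'n::finite cmat) ** (\<Sum>k\<in>K. f k) = (\<Sum>k\<in>K. N ** f k)"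
  by (simp add: matrix_matrix_mult_def vec_eq_iff sum_distrib_left sum.swap[of _ K])

lemma matrix_mult_diff_left: "(M - M') ** (N :: 'n::finite cmat) = M ** N - M' ** N"
  by (simp add: matrix_matrix_mult_def vec_eq_iff left_diff_distrib sum_subtractf)

lemma matrix_mult_diff_right: "(N :: 'n::finite cmat) ** (M - M') = N ** M - N ** M'"
  by (simp add: matrix_matrix_mult_def vec_eq_iff right_diff_distrib sum_subtractf)

text \<open>The inner product of the type \<open>complex^'n^'n\<close> is the real part of the
  Hilbert-Schmidt product, so trace estimates become estimates in a real inner product
  space.\<close>

lemma Re_mtrace_madj_mult: "Re (mtrace (madj M ** N)) = M \<bullet> N"
  unfolding mtrace_def matrix_matrix_mult_def madj_def inner_vec_def
  by (simp, subst sum.swap) (simp add: inner_complex_def)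

text \<open>Taking the trace turns the hypothesis into a vanishing sum of squared Hilbert-Schmidt
  norms.\<close>

lemma sum_madj_mult_eq_0:
  fixes X :: "'k::finite \<Rightarrow> 'n::finite cmat"
  assumes "(\<Sum>k\<in>UNIV. madj (X k) ** X k) = 0"
  shows "X k = 0"
proof -
  have "(\<Sum>k\<in>UNIV. X k \<bullet> X k) = Re (mtrace (\<Sum>k\<in>UNIV. madj (X k) ** X k))"
    by (simp add: mtrace_sum Re_mtrace_madj_mult)
  then have "(\<Sum>k\<in>UNIV. X k \<bullet> X k) = 0"
    by (simp add: assms mtrace_def)
  then show ?thesis
    by (simp add: sum_nonneg_eq_0_iff)
qed

section \<open>Sesquilinear forms and rank-one decompositions of positive operators\<close>

definition sesq :: "'n::finite cmat \<Rightarrow> complex^'n \<Rightarrow> complex^'n \<Rightarrow> complex" where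
  "sesq M u v = (\<Sum>i\<in>UNIV. \<Sum>j\<in>UNIV. cnj (u $ i) * M $ i $ j * v $ j)"

lemma sesq_add_left: "sesq M (u + u') v = sesq M u v + sesq M u' v"
  by (simp add: sesq_def distrib_right sum.distrib)

lemma sesq_add_right: "sesq M u (v + v') = sesq M u v + sesq M u v'"
  by (simp add: sesq_def distrib_left sum.distrib)

lemma sesq_diff_left: "sesq M (u - u') v = sesq M u v - sesq M u' v"
  by (simp add: sesq_def left_diff_distrib sum_subtractf)

lemma sesq_diff_right: "sesq M u (v - v') = sesq M u v - sesq M u v'"
  by (simp add: sesq_def right_diff_distrib sum_subtractf)

lemma sesq_axis_left: "sesq M (axis i a) v = cnj a * (\<Sum>j\<in>UNIV. M $ i $ j * v $ j)"
proof -
  have "cnj (axis i a $ k) * M $ k $ j * v $ j = (if k = i then cnj a * (M $ i $ j * v $ j) else 0)" for k j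
    by (simp add: axis_def)
  then show ?thesis
    unfolding sesq_def by (simp add: sum.swap[of _ "UNIV"] sum_distrib_left)
qed

lemma sesq_axis_right: "sesq M u (axis j b) = (\<Sum>i\<in>UNIV. cnj (u $ i) * M $ i $ j) * b"
proof -
  have "cnj (u $ i) * M $ i $ k * axis j b $ k = (if k = j then cnj (u $ i) * M $ i $ j * b else 0)" for k i
    by (simp add: axis_def)
  then show ?thesis
    unfolding sesq_def by (simp add: sum_distrib_right)
qed

lemma sesq_axis: "sesq M (axis i a) (axis j b) = cnj a * M $ i $ j * b"
proof -
  have "M $ i $ k * axis j b $ k = (if k = j then M $ i $ j * b else 0)" for k
    by (simp add: axis_def)
  then show ?thesis by (simp add: sesq_axis_left)
qed

lemma positive_op_sesq: "positive_op M \<longleftrightarrow> (\<forall>v. Im (sesq M v v) = 0 \<and> Re (sesq M v v) \<ge> 0)"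
  by (simp add: positive_op_def sesq_def Let_def)

lemma positive_op_hermitian:
  assumes "positive_op M"
  shows "M $ j $ i = cnj (M $ i $ j)"
proof -
  have q: "Im (sesq M v v) = 0" for v
    using assms by (simp add: positive_op_sesq)
  have d: "Im (M $ k $ k) = 0" for k
    using q[of "axis k 1"] by (simp add: sesq_axis)
  \<comment> \<open>Polarization: coefficients 1 and 1 compare the imaginary parts of the two
    entries; coefficients 1 and i, used next, compare the real parts.\<close>
  have "Im (M $ i $ j + M $ j $ i) = 0"
    using q[of "axis i 1 + axis j 1"] d[of i] d[of j]
    by (simp add: sesq_add_left sesq_add_right sesq_axis)
  moreover have "Re (M $ i $ j) - Re (M $ j $ i) = 0"
    using q[of "axis i 1 + axis j \<i>"] d[of i] d[of j]
    by (simp add: sesq_add_left sesq_add_right sesq_axis)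
  ultimately show ?thesis by (simp add: complex_eq_iff)
qed

lemma positive_op_diag:
  assumes "positive_op M"
  shows "M $ i $ i = of_real (Re (M $ i $ i))" "Re (M $ i $ i) \<ge> 0"
  using assms[unfolded positive_op_sesq, rule_format, of "axis i 1"]
  by (simp_all add: sesq_axis complex_eq_iff)

text \<open>A nonzero entry M_ij would make the form negative at e_i - cnj(M_ij) e_j: with a zero
  diagonal its value there is -2 |M_ij|^2.\<close>

lemma positive_op_eq_0:
  assumes M: "positive_op M" and diag: "\<And>i. M $ i $ i = 0"
  shows "M = 0"
proof -
  have "M $ i $ j = 0" for i j
  proof -
    have "Re (sesq M (axis i 1 + axis j (- cnj (M $ i $ j))) (axis i 1 + axis j (- cnj (M $ i $ j)))) \<ge> 0"
      using M unfolding positive_op_sesq by blast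
    moreover have "sesq M (axis i 1 + axis j (- cnj (M $ i $ j))) (axis i 1 + axis j (- cnj (M $ i $ j)))
        = - of_real (2 * (cmod (M $ i $ j))\<^sup>2)"
      using positive_op_hermitian[OF M, of j i]
      by (simp add: sesq_add_left sesq_add_right sesq_axis diag complex_norm_square del: of_real_power)
    ultimately show ?thesis by simp
  qed
  then show ?thesis by (simp add: vec_eq_iff)
qed

text \<open>Completing the square: the form of the Schur complement at \<open>v\<close> is the form
  of \<open>M\<close> at \<open>v - axis i (s / m)\<close>.\<close>

lemma positive_op_schur_complement:
  assumes M: "positive_op M" and i: "M $ i $ i \<noteq> 0"
  shows "positive_op (\<chi> j k. M $ j $ k - M $ j $ i * M $ i $ k / M $ i $ i)"
    (is "positive_op ?M'")
  unfolding positive_op_sesq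
proof
  fix v :: "complex^'a"
  define s where "s = (\<Sum>k\<in>UNIV. M $ i $ k * v $ k)"
  define m where "m = M $ i $ i"
  have m: "cnj m = m" "m \<noteq> 0"
    using positive_op_hermitian[OF M, of i i] i by (simp_all add: m_def)
  have s': "(\<Sum>k\<in>UNIV. cnj (v $ k) * M $ k $ i) = cnj s"
    using positive_op_hermitian[OF M, of _ i] by (simp add: s_def mult.commute)
  have "(\<Sum>j\<in>UNIV. \<Sum>k\<in>UNIV. cnj (v $ j) * (M $ j $ i * M $ i $ k / m) * v $ k)
     = (\<Sum>k\<in>UNIV. cnj (v $ k) * M $ k $ i) * s / m"
    unfolding s_def sum_product sum_divide_distrib by (simp add: mult.assoc)
  then have 1: "sesq ?M' v v = sesq M v v - cnj s * s / m"
    by (simp add: sesq_def left_diff_distrib right_diff_distrib sum_subtractf s' m_def[symmetric])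
  have 2: "sesq M (v - axis i (s / m)) (v - axis i (s / m)) = sesq M v v - cnj s * s / m"
    using m by (simp add: sesq_diff_left sesq_diff_right sesq_axis,
        simp add: sesq_axis_left sesq_axis_right s' s_def[symmetric] m_def[symmetric])
  show "Im (sesq ?M' v v) = 0 \<and> 0 \<le> Re (sesq ?M' v v)"
    using M unfolding 1 2[symmetric] positive_op_sesq by blast
qed

text \<open>A Cholesky decomposition: each step splits off the rank-one matrix of a pivot column and
  continues with the Schur complement.\<close>

lemma positive_op_sum_rank_one:
  fixes M :: "'n::finite cmat"
  assumes "positive_op M"
  shows "\<exists>x :: 'n \<Rightarrow> complex^'n. \<forall>i j. M $ i $ j = (\<Sum>k\<in>UNIV. x k $ i * cnj (x k $ j))"
proof -
  \<comment> \<open>The set \<open>I\<close> contains all indices with nonzero diagonal entry. Since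
    \<open>x k\<close> vanishes outside \<open>I\<close>, slot \<open>i\<close> is free for the
    vector of a new pivot.\<close>
  have "\<exists>x :: 'n \<Rightarrow> complex^'n. (\<forall>k. k \<notin> I \<longrightarrow> x k = 0) \<and>
          (\<forall>i j. M $ i $ j = (\<Sum>k\<in>UNIV. x k $ i * cnj (x k $ j)))"
    if "positive_op M" "{i. M $ i $ i \<noteq> 0} \<subseteq> I" for I and M :: "'n cmat"
    using finite[of I] that
  proof (induction I arbitrary: M rule: finite_induct)
    case empty
    then have "M = 0" by (intro positive_op_eq_0) auto
    then show ?case by (intro exI[of _ "\<lambda>_. 0"]) simp
  next
    case (insert i I)
    show ?case
    proof (cases "M $ i $ i = 0")
      case True
      with insert.prems have "{j. M $ j $ j \<noteq> 0} \<subseteq> I" by auto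
      from insert.IH[OF insert.prems(1) this] show ?thesis by blast
    next
      case False
      define M' :: "'n cmat" where "M' = (\<chi> j k. M $ j $ k - M $ j $ i * M $ i $ k / M $ i $ i)"
      have pos': "positive_op M'"
        unfolding M'_def by (rule positive_op_schur_complement[OF insert.prems(1) False])
      define m where "m = Re (M $ i $ i)"
      have m: "M $ i $ i = of_real m" "m > 0"
        using positive_op_diag[OF insert.prems(1), of i] False
        by (auto simp: m_def order_le_less complex_eq_iff)
      \<comment> \<open>Zeros on the diagonal persist: the new entry is -|M_ji|^2 / m, while
        positivity of \<open>M'\<close> makes it nonnegative.\<close>
      have "M' $ j $ j = 0" if "M $ j $ j = 0" for j
      proof -
        have "M' $ j $ j = - of_real ((cmod (M $ j $ i))\<^sup>2 / m)"
          using positive_op_hermitian[OF insert.prems(1), of i j] that m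
          by (simp add: M'_def complex_norm_square del: of_real_power)
        with positive_op_diag(2)[OF pos', of j] show ?thesis
          using m by (simp add: zero_le_divide_iff divide_le_0_iff del: of_real_power of_real_divide)
      qed
      moreover have "M' $ i $ i = 0" using False by (simp add: M'_def)
      ultimately have "{j. M' $ j $ j \<noteq> 0} \<subseteq> I" using insert.prems(2) by auto
      from insert.IH[OF pos' this] obtain x :: "'n \<Rightarrow> complex^'n"
        where x: "\<And>k. k \<notin> I \<Longrightarrow> x k = 0"
          "\<And>j l. M' $ j $ l = (\<Sum>k\<in>UNIV. x k $ j * cnj (x k $ l))" by blast
      \<comment> \<open>Dividing by the root of the pivot makes the rank-one matrix of
        \<open>y i\<close> equal to the term subtracted in \<open>M'\<close>.\<close>
      define y where "y = x(i := \<chi> j. M $ j $ i / of_real (sqrt m))"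
      have yi: "y i $ j * cnj (y i $ l) = M $ j $ i * M $ i $ l / M $ i $ i" for j l
      proof -
        have "complex_of_real (sqrt m) * of_real (sqrt m) = of_real m"
          using m(2) by (simp flip: of_real_mult)
        then show ?thesis
          using positive_op_hermitian[OF insert.prems(1), of i l] m
          by (simp add: y_def)
      qed
      have "M $ j $ l = (\<Sum>k\<in>UNIV. y k $ j * cnj (y k $ l))" for j l
      proof -
        have "(\<Sum>k\<in>UNIV. y k $ j * cnj (y k $ l))
            = y i $ j * cnj (y i $ l) + (\<Sum>k\<in>UNIV - {i}. x k $ j * cnj (x k $ l))"
          by (subst sum.remove[of _ i]) (auto simp: y_def intro!: sum.cong)
        also have "(\<Sum>k\<in>UNIV - {i}. x k $ j * cnj (x k $ l)) = M' $ j $ l"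
          using x(1)[OF insert.hyps(2)] by (simp add: x(2) sum.remove[of UNIV i])
        finally show ?thesis by (simp add: yi M'_def)
      qed
      moreover have "\<forall>k. k \<notin> insert i I \<longrightarrow> y k = 0" using x(1) by (simp add: y_def)
      ultimately show ?thesis by blast
    qed
  qed
  from this[OF assms, of UNIV] show ?thesis by blast
qed

section \<open>Spectral decomposition and the cost operator of a qubit observable\<close>

lemma diag_mat_mult: "diag_mat d ** diag_mat e = diag_mat (\<lambda>i. d i * e i)"
proof -
  have "(if i = k then d i else 0) * (if k = j then e k else 0)
      = (if k = i then if i = j then d i * e i else 0 else 0)" for i j k
    by simp
  then show ?thesis
    by (simp add: diag_mat_def matrix_matrix_mult_def vec_eq_iff)
qed

lemma conj_diag_component:
  "(U ** diag_mat d ** madj U) $ i $ j = (\<Sum>k\<in>UNIV. U $ i $ k * d k * cnj (U $ j $ k))"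
proof -
  have "U $ i $ k * (if k = l then d k else 0) = (if k = l then U $ i $ l * d l else 0)" for k l
    by simp
  then show ?thesis
    by (simp add: matrix_matrix_mult_def diag_mat_def madj_def)
qed

lemma madj_conj_diag:
  "madj (U ** diag_mat (\<lambda>i. of_real (d i)) ** madj U) = U ** diag_mat (\<lambda>i. of_real (d i)) ** madj U"
proof -
  have "cnj ((U ** diag_mat (\<lambda>i. of_real (d i)) ** madj U) $ j $ i)
      = (U ** diag_mat (\<lambda>i. of_real (d i)) ** madj U) $ i $ j" for i j
    unfolding conj_diag_component by (simp add: mult_ac)
  then show ?thesis by (simp add: vec_eq_iff madj_def[of "_ ** _"])
qed

lemma conj_diag_scaleR:
  "c *\<^sub>R (U ** diag_mat d ** madj U) = U ** diag_mat (\<lambda>i. of_real c * d i) ** madj U"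
  by (simp add: vec_eq_iff conj_diag_component scaleR_sum_right)
     (simp add: scaleR_conv_of_real mult_ac)

lemma conj_diag_mult:
  assumes "unitary_mat U"
  shows "(U ** diag_mat d ** madj U) ** (U ** diag_mat e ** madj U)
       = U ** diag_mat (\<lambda>i. d i * e i) ** madj U"
proof -
  have "(U ** diag_mat d ** madj U) ** (U ** diag_mat e ** madj U)
      = U ** diag_mat d ** (madj U ** U) ** diag_mat e ** madj U"
    by (simp add: matrix_mul_assoc)
  also have "\<dots> = U ** (diag_mat d ** diag_mat e) ** madj U"
    using assms by (simp add: unitary_mat_def matrix_mul_assoc)
  finally show ?thesis by (simp add: diag_mat_mult)
qed

lemma conj_diag_inject:
  assumes "unitary_mat U" "U ** diag_mat d ** madj U = U ** diag_mat e ** madj U"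
  shows "d = e"
proof -
  have "madj U ** (U ** diag_mat f ** madj U) ** U = diag_mat f" for f
  proof -
    have "madj U ** (U ** diag_mat f ** madj U) ** U = (madj U ** U) ** diag_mat f ** (madj U ** U)"
      by (simp add: matrix_mul_assoc)
    then show ?thesis using assms(1) by (simp add: unitary_mat_def)
  qed
  with assms(2) have "diag_mat d = diag_mat e" by metis
  then show ?thesis by (simp add: diag_mat_def vec_eq_iff fun_eq_iff) metis
qed

text \<open>Each \<open>d k\<close> is the value of the quadratic form at the \<open>k\<close>-th
  column of \<open>U\<close>.\<close>

lemma positive_op_eigenvalues_nonneg:
  assumes "unitary_mat U" "positive_op (U ** diag_mat (\<lambda>i. of_real (d i)) ** madj U)"
  shows "d k \<ge> 0"
proof -
  let ?M = "U ** diag_mat (\<lambda>i. of_real (d i)) ** madj U"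
  have "sesq ?M (column k U) (column k U) = (madj U ** ?M ** U) $ k $ k"
  proof -
    have *: "(madj U ** M ** U) $ k $ k = sesq M (column k U) (column k U)" for M
      by (simp add: sesq_def column_def matrix_matrix_mult_def madj_def sum_distrib_right)
        (rule sum.swap)
    show ?thesis by (rule *[symmetric])
  qed
  also have "madj U ** ?M ** U = (madj U ** U) ** diag_mat (\<lambda>i. of_real (d i)) ** (madj U ** U)"
    by (simp add: matrix_mul_assoc)
  also have "\<dots> $ k $ k = of_real (d k)"
    using assms(1) by (simp add: unitary_mat_def diag_mat_def)
  finally show ?thesis using assms(2) by (auto simp: positive_op_sesq dest: spec[of _ "column k U"])
qed

lemma spectral_decomposition_2:
  fixes A :: "2 cmat"
  assumes "self_adjoint A"
  shows "\<exists>U d. unitary_mat U \<and> A = U ** diag_mat (\<lambda>i. complex_of_real (d i)) ** madj U"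
proof -
  have h: "A $ j $ i = cnj (A $ i $ j)" for i j
    using assms by (simp add: self_adjoint_def madj_def vec_eq_iff)
  define a where "a = Re (A $ 1 $ 1)"
  define c where "c = Re (A $ 2 $ 2)"
  define b where "b = A $ 1 $ 2"
  have A: "A $ 1 $ 1 = of_real a" "A $ 2 $ 2 = of_real c" "A $ 1 $ 2 = b" "A $ 2 $ 1 = cnj b"
    using h[of 1 1] h[of 2 2] h[of 2 1] by (auto simp: a_def b_def c_def complex_eq_iff)
  show ?thesis
  proof (cases "b = 0")
    case True
    then have "A = mat 1 ** diag_mat (\<lambda>i. complex_of_real (if i = 1 then a else c)) ** madj (mat 1)"
      by (simp add: vec_eq_iff forall_2 diag_mat_def A)
    moreover have "unitary_mat (mat 1 :: 2 cmat)" by (simp add: unitary_mat_def)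
    ultimately show ?thesis by (intro exI conjI)
  next
    case False
    define s where "s = sqrt (((a - c) / 2)\<^sup>2 + (cmod b)\<^sup>2)"
    define l where "l = (a + c) / 2 + s"
    define m where "m = (a + c) / 2 - s"
    have "s\<^sup>2 = ((a - c) / 2)\<^sup>2 + (cmod b)\<^sup>2"
      by (simp add: s_def)
    then have char: "(l - a) * (l - c) = (cmod b)\<^sup>2"
      by (simp add: l_def power2_eq_square field_simps)
    define n where "n = sqrt ((cmod b)\<^sup>2 + (l - a)\<^sup>2)"
    have n: "n\<^sup>2 = (cmod b)\<^sup>2 + (l - a)\<^sup>2" by (simp add: n_def)
    have n0: "n \<noteq> 0" using False by (simp add: n_def add_nonneg_eq_0_iff)
    define r :: complex where "r = of_real (l - a)"
    have bb: "b * cnj b = of_real ((l - a) * (l - c))"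
      unfolding char by (simp only: complex_norm_square)
    have nn: "of_real n * of_real n = b * cnj b + r * r"
      using n by (simp add: r_def power2_eq_square flip: of_real_mult of_real_add)
        (simp add: power2_eq_square[symmetric] flip: complex_norm_square)
    have nC: "complex_of_real n \<noteq> 0" using n0 by simp
    \<comment> \<open>The columns are the orthogonal eigenvectors (b, l - a) and (-(l - a), cnj b)
      for \<open>l\<close> and \<open>m\<close>, divided by their common norm
      \<open>n\<close>.\<close>
    define U :: "2 cmat" where
      "U = (\<chi> i j. (if j = 1 then if i = 1 then b else r else if i = 1 then - r else cnj b) / of_real n)"
    have U: "U $ 1 $ 1 = b / of_real n" "U $ 2 $ 1 = r / of_real n"
      "U $ 1 $ 2 = - r / of_real n" "U $ 2 $ 2 = cnj b / of_real n"
      by (simp_all add: U_def)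
    have r: "cnj r = r" by (simp add: r_def)
    have n': "b * cnj b / (of_real n * of_real n) + r * r / (of_real n * of_real n) = 1"
      unfolding add_divide_distrib[symmetric] nn[symmetric] using nC by simp
    have un: "unitary_mat U"
      using n'
      by (simp add: unitary_mat_def vec_eq_iff forall_2 matrix_matrix_mult_def sum_2 madj_def mat_def U r
          mult.commute add.commute)
    define d where "d i = (if i = (1::2) then l else m)" for i
    have "A ** U = U ** diag_mat (\<lambda>i. complex_of_real (d i))"
    proof -
      have m: "m = a + c - l" by (simp add: m_def l_def)
      have "of_real c * r + b * cnj b = r * of_real l"
        unfolding bb by (simp add: r_def algebra_simps)
      moreover have "b * cnj b = r * of_real a + r * (of_real l - of_real a - of_real c) + r * 0"
        unfolding bb by (simp add: r_def algebra_simps)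
      ultimately show ?thesis using nC
        by (simp add: vec_eq_iff forall_2 matrix_matrix_mult_def sum_2 diag_mat_def U A d_def m field_simps)
           (simp add: r_def algebra_simps)
    qed
    then have "U ** diag_mat (\<lambda>i. complex_of_real (d i)) ** madj U = A ** (U ** madj U)"
      by (simp add: matrix_mul_assoc)
    then show ?thesis using un by (auto simp: unitary_mat_def)
  qed
qed

text \<open>The condition on \<open>d\<close> confines the eigenvalues to 0, \<open>c\<close> and
  \<open>-c\<close>, where |t|^p = c^(p-2) t^2.\<close>

lemma abs_pow_three_eigenvalues:
  assumes U: "unitary_mat U" and X: "X = U ** diag_mat (\<lambda>i. complex_of_real (d i)) ** madj U"
    and c: "c \<ge> 0" "\<And>i. (d i)^3 = c\<^sup>2 * d i"
  shows "abs_pow X p = (c powr (p - 2)) *\<^sub>R (X ** X)"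
proof -
  \<comment> \<open>\<open>abs_pow\<close> picks an arbitrary diagonalization, so the eigenvalue
    condition is restated as X^3 = c^2 X, which every diagonalization inherits.\<close>
  have XXX: "X ** X ** X = c\<^sup>2 *\<^sub>R X"
  proof -
    have "d i * d i * d i = c\<^sup>2 * d i" for i
      using c(2)[of i] by (simp add: power3_eq_cube)
    then show ?thesis
      by (simp only: X conj_diag_mult[OF U] conj_diag_scaleR flip: of_real_mult)
  qed
  have unique: "M = (c powr (p - 2)) *\<^sub>R (X ** X)"
    if V: "unitary_mat V" and XV: "X = V ** diag_mat (\<lambda>i. complex_of_real (e i)) ** madj V"
      and M: "M = V ** diag_mat (\<lambda>i. complex_of_real (\<bar>e i\<bar> powr p)) ** madj V" for V e M
  proof -
    have "V ** diag_mat (\<lambda>i. complex_of_real (e i ^ 3)) ** madj V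
        = V ** diag_mat (\<lambda>i. complex_of_real (c\<^sup>2 * e i)) ** madj V"
      using XXX unfolding XV
      by (simp add: conj_diag_mult[OF V] conj_diag_scaleR power3_eq_cube)
    from conj_diag_inject[OF V this] have e3: "e i ^ 3 = c\<^sup>2 * e i" for i
      by (metis of_real_eq_iff)
    \<comment> \<open>At the eigenvalue 0 both sides vanish, because
      \<open>0 powr p = 0\<close>.\<close>
    have "\<bar>e i\<bar> powr p = c powr (p - 2) * (e i * e i)" for i
    proof (cases "e i = 0")
      case False
      with e3[of i] have "(e i)\<^sup>2 = c\<^sup>2"
        by (simp add: power3_eq_cube power2_eq_square)
      then have "\<bar>e i\<bar> = c" "c > 0"
        using c(1) False by (auto simp: power2_eq_iff order_le_less)
      then show ?thesis using \<open>(e i)\<^sup>2 = c\<^sup>2\<close>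
        by (simp add: powr_diff power2_eq_square)
    qed simp
    then show ?thesis
      by (simp add: M XV conj_diag_mult[OF V] conj_diag_scaleR flip: of_real_mult)
  qed
  show ?thesis
    unfolding abs_pow_def
  proof (rule some_equality)
    have "c powr (p - 2) *\<^sub>R (X ** X) = U ** diag_mat (\<lambda>i. complex_of_real (\<bar>d i\<bar> powr p)) ** madj U"
      using unique[OF U X refl] by simp
    then show "\<exists>U d. unitary_mat U \<and> X = U ** diag_mat (\<lambda>i. complex_of_real (d i)) ** madj U \<and>
      c powr (p - 2) *\<^sub>R (X ** X) = U ** diag_mat (\<lambda>i. complex_of_real (\<bar>d i\<bar> powr p)) ** madj U"
      using U X by blast
  qed (use unique in blast)
qed

text \<open>The matrix U (x) conj(U). The conjugate sits on the dual factor because A = U D U* gives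
  A^T = conj(U) D U^T for diagonal D.\<close>

definition kron_cnj :: "'n::finite cmat \<Rightarrow> ('n \<times> 'n) cmat" where
  "kron_cnj U = (\<chi> x y. U $ fst x $ fst y * cnj (U $ snd x $ snd y))"

lemma sum_UNIV_prod:
  "(\<Sum>x\<in>UNIV. f x) = (\<Sum>a\<in>UNIV. \<Sum>b\<in>UNIV. f (a :: 'a::finite, b :: 'b::finite))"
  by (simp add: sum.cartesian_product)

lemma unitary_kron_cnj:
  assumes "unitary_mat U"
  shows "unitary_mat (kron_cnj U)"
proof -
  have 1: "(\<Sum>k\<in>UNIV. U $ i $ k * cnj (U $ j $ k)) = (if i = j then 1 else 0)"
    and 2: "(\<Sum>k\<in>UNIV. cnj (U $ k $ i) * U $ k $ j) = (if i = j then 1 else 0)" for i j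
    using assms by (simp_all add: unitary_mat_def vec_eq_iff matrix_matrix_mult_def madj_def mat_def)
  have "(kron_cnj U ** madj (kron_cnj U)) $ x $ y
      = (\<Sum>k\<in>UNIV. U $ fst x $ k * cnj (U $ fst y $ k)) * cnj (\<Sum>l\<in>UNIV. U $ snd x $ l * cnj (U $ snd y $ l))"
    and "(madj (kron_cnj U) ** kron_cnj U) $ x $ y
      = (\<Sum>k\<in>UNIV. cnj (U $ k $ fst x) * U $ k $ fst y) * cnj (\<Sum>l\<in>UNIV. cnj (U $ l $ snd x) * U $ l $ snd y)"
    for x y
    by (simp_all add: matrix_matrix_mult_def kron_cnj_def madj_def sum_UNIV_prod sum_product mult_ac)
  then show ?thesis
    by (auto simp: unitary_mat_def vec_eq_iff 1 2 mat_def prod_eq_iff)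
qed

text \<open>Both terms are diagonal in the basis given by U (x) conj(U), with eigenvalues
  \<open>a i\<close> and \<open>a j\<close>. On matrices, read as vectors, the difference acts as
  the commutator X -> A X - X A.\<close>

lemma commutator_op_decomposition:
  assumes U: "unitary_mat U" and A: "A = U ** diag_mat (\<lambda>i. complex_of_real (a i)) ** madj U"
  shows "left_op A - right_op (mtransp A)
       = kron_cnj U ** diag_mat (\<lambda>x. complex_of_real (a (fst x) - a (snd x))) ** madj (kron_cnj U)"
proof -
  have 1: "(\<Sum>k\<in>UNIV. U $ i $ k * cnj (U $ j $ k)) = (if i = j then 1 else 0)" for i j
    using U by (simp add: unitary_mat_def vec_eq_iff matrix_matrix_mult_def madj_def mat_def)
  have 2: "A $ i $ j = (\<Sum>k\<in>UNIV. U $ i $ k * of_real (a k) * cnj (U $ j $ k))" for i j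
    unfolding A by (rule conj_diag_component)
  have "(kron_cnj U ** diag_mat (\<lambda>x. complex_of_real (a (fst x) - a (snd x))) ** madj (kron_cnj U)) $ x $ y
      = (\<Sum>k\<in>UNIV. U $ fst x $ k * of_real (a k) * cnj (U $ fst y $ k))
          * cnj (\<Sum>l\<in>UNIV. U $ snd x $ l * cnj (U $ snd y $ l))
      - (\<Sum>k\<in>UNIV. U $ fst x $ k * cnj (U $ fst y $ k))
          * (\<Sum>l\<in>UNIV. U $ snd y $ l * of_real (a l) * cnj (U $ snd x $ l))" for x y
    unfolding conj_diag_component
    by (simp add: kron_cnj_def sum_UNIV_prod sum_product algebra_simps sum_subtractf) (rule sum.swap)
  then show ?thesis
    by (auto simp add: vec_eq_iff 1 2[symmetric] left_op_def right_op_def mtransp_def)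
qed

text \<open>Dimension two enters here: the differences of two eigenvalues are 0, c and -c with c =
  |a 1 - a 2|.\<close>

lemma abs_pow_commutator_op:
  fixes A :: "2 cmat"
  assumes "self_adjoint A"
  shows "\<exists>w\<ge>0. abs_pow (left_op A - right_op (mtransp A)) p
           = w *\<^sub>R ((left_op A - right_op (mtransp A)) ** (left_op A - right_op (mtransp A)))"
proof -
  obtain U a where U: "unitary_mat U" and A: "A = U ** diag_mat (\<lambda>i. complex_of_real (a i)) ** madj U"
    using spectral_decomposition_2[OF assms] by blast
  have "(a (fst x) - a (snd x))^3 = \<bar>a 1 - a 2\<bar>\<^sup>2 * (a (fst x) - a (snd x))" for x
    using exhaust_2[of "fst x"] exhaust_2[of "snd x"]
    by (auto simp: power3_eq_cube power2_eq_square) (simp add: algebra_simps)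
  from abs_pow_three_eigenvalues[OF unitary_kron_cnj[OF U] commutator_op_decomposition[OF U A] _ this]
  show ?thesis by (intro exI[of _ "\<bar>a 1 - a 2\<bar> powr (p - 2)"]) simp
qed

text \<open>\<open>S ** S\<close> is the Moore-Penrose inverse of \<open>R\<close>; the eigenvalue 0 needs no separate
  treatment because \<open>0 powr a = 0\<close>.\<close>
lemma ex_sqrt_pinv:
  assumes U: "unitary_mat U" and \<tau>: "\<tau> = U ** diag_mat (\<lambda>i. complex_of_real (d i)) ** madj U"
    and pos: "positive_op \<tau>"
  shows "\<exists>R S. madj R = R \<and> madj S = S \<and> R ** R = \<tau> \<and> R ** (S ** S) = S ** S ** R \<and> R ** (S ** S) ** R = R"
proof (intro exI conjI)
  have d: "d i \<ge> 0" for i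
    using positive_op_eigenvalues_nonneg[OF U pos[unfolded \<tau>]] .
  let ?R = "U ** diag_mat (\<lambda>i. complex_of_real (d i powr (1/2))) ** madj U"
  \<comment> \<open>The exponent -1/4 makes \<open>S ** S\<close> the power -1/2 of \<tau> on its
    support; \<open>S\<close> later splits that power evenly between two factors.\<close>
  let ?S = "U ** diag_mat (\<lambda>i. complex_of_real (d i powr (-1/4))) ** madj U"
  show "madj ?R = ?R" "madj ?S = ?S" by (rule madj_conj_diag)+
  show "?R ** ?R = \<tau>"
    using d by (simp add: conj_diag_mult[OF U] \<tau> flip: of_real_mult powr_add)
  show "?R ** (?S ** ?S) = ?S ** ?S ** ?R"
    by (simp add: conj_diag_mult[OF U] mult_ac)
  have "d i powr (1/2) * (d i powr (-1/4) * d i powr (-1/4)) * d i powr (1/2) = d i powr (1/2)" for i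
  proof -
    have "d i powr (1/2) * (d i powr (-1/4) * d i powr (-1/4)) * d i powr (1/2)
       = d i powr (1/2 + (-1/4 + -1/4) + 1/2)" by (simp only: powr_add)
    then show ?thesis by simp
  qed
  then show "?R ** (?S ** ?S) ** ?R = ?R"
    by (simp only: conj_diag_mult[OF U] flip: of_real_mult)
qed

section \<open>Kraus families and couplings\<close>

text \<open>The sum of the rank-one operators |X_k><X_k|, each matrix being read as a vector of H
  (x) H*; this is the Choi matrix of the map with Kraus operators \<open>X k\<close>.\<close>

definition kraus_op :: "('k::finite \<Rightarrow> 'n::finite cmat) \<Rightarrow> ('n \<times> 'n) cmat" where
  "kraus_op X = (\<chi> x y. \<Sum>k\<in>UNIV. X k $ fst x $ snd x * cnj (X k $ fst y $ snd y))"

text \<open>The two sums are the marginals of \<open>kraus_op X\<close>, with the transposition on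
  the dual factor undone.\<close>

definition kraus_coupling :: "'n::finite cmat \<Rightarrow> 'n cmat \<Rightarrow> ('k::finite \<Rightarrow> 'n cmat) \<Rightarrow> bool" where
  "kraus_coupling \<rho> \<omega> X \<longleftrightarrow>
     (\<Sum>k\<in>UNIV. madj (X k) ** X k) = \<rho> \<and> (\<Sum>k\<in>UNIV. X k ** madj (X k)) = \<omega>"

lemma ptrace_dual_kraus_op: "ptrace_dual (kraus_op X) = (\<Sum>k\<in>UNIV. X k ** madj (X k))"
  by (simp add: ptrace_dual_def kraus_op_def vec_eq_iff matrix_matrix_mult_def madj_def)
     (intro allI sum.swap)

lemma ptrace_H_kraus_op: "ptrace_H (kraus_op X) = mtransp (\<Sum>k\<in>UNIV. madj (X k) ** X k)"
  by (simp add: ptrace_H_def mtransp_def kraus_op_def vec_eq_iff matrix_matrix_mult_def madj_def mult.commute)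
     (intro allI sum.swap)

lemma mtransp_inject [simp]: "mtransp M = mtransp N \<longleftrightarrow> M = N"
  by (auto simp: mtransp_def vec_eq_iff)

lemma mtrace_ptrace_dual: "mtrace (ptrace_dual P) = mtrace P"
  by (simp add: mtrace_def ptrace_dual_def sum_UNIV_prod)

lemma positive_op_kraus_op:
  fixes X :: "'k::finite \<Rightarrow> 'n::finite cmat"
  shows "positive_op (kraus_op X)"
proof -
  have "sesq (kraus_op X) v v = (\<Sum>k\<in>UNIV. of_real ((cmod (\<Sum>x\<in>UNIV. cnj (v $ x) * X k $ fst x $ snd x))\<^sup>2))" for v
  proof -
    have "sesq (kraus_op X) v v = (\<Sum>k\<in>UNIV. \<Sum>x\<in>UNIV. \<Sum>y\<in>UNIV.
        cnj (v $ x) * X k $ fst x $ snd x * cnj (cnj (v $ y) * X k $ fst y $ snd y))"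
      unfolding sesq_def kraus_op_def
      by (simp add: sum_distrib_left sum_distrib_right mult_ac sum.swap[of _ _ "UNIV :: 'k set"])
    then show ?thesis
      by (simp only: complex_norm_square cnj_sum sum_product)
  qed
  then show ?thesis
    by (simp add: positive_op_sesq sum_nonneg flip: of_real_power)
qed

lemma kraus_op_in_couplings:
  assumes "kraus_coupling \<rho> \<omega> X" "mtrace \<omega> = 1"
  shows "kraus_op X \<in> couplings \<rho> \<omega>"
  using assms mtrace_ptrace_dual[of "kraus_op X"]
  by (simp add: couplings_def states_def positive_op_kraus_op kraus_coupling_def
      ptrace_dual_kraus_op ptrace_H_kraus_op)

text \<open>The vectors of a rank-one decomposition of \<open>P\<close>, reshaped into matrices,
  form the family.\<close>

lemma couplings_imp_kraus:
  fixes \<rho> :: "'n::finite cmat"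
  assumes "P \<in> couplings \<rho> \<omega>"
  obtains X :: "'n \<times> 'n \<Rightarrow> 'n cmat" where "P = kraus_op X" "kraus_coupling \<rho> \<omega> X"
proof -
  have "positive_op P" using assms by (simp add: couplings_def states_def)
  from positive_op_sum_rank_one[OF this] obtain x :: "'n \<times> 'n \<Rightarrow> complex^('n \<times> 'n)"
    where x: "\<And>i j. P $ i $ j = (\<Sum>k\<in>UNIV. x k $ i * cnj (x k $ j))" by blast
  define X :: "'n \<times> 'n \<Rightarrow> 'n cmat" where "X k = (\<chi> i j. x k $ (i, j))" for k
  have P: "P = kraus_op X"
    by (simp add: vec_eq_iff kraus_op_def X_def x)
  with assms show ?thesis
    by (intro that[OF P]) (simp add: couplings_def kraus_coupling_def ptrace_dual_kraus_op ptrace_H_kraus_op)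
qed

text \<open>For self-adjoint \<open>A\<close> each summand is Re tr(X_k* A X_k A), the mixed term in
  the squared norm of A X_k - X_k A.\<close>

definition corr :: "'n::finite cmat \<Rightarrow> ('k::finite \<Rightarrow> 'n cmat) \<Rightarrow> real" where
  "corr A X = (\<Sum>k\<in>UNIV. (A ** X k) \<bullet> (X k ** A))"

section \<open>Traces of one-sided operators and the cost of a Kraus family\<close>

lemma mtrace_left_op: "mtrace (P ** left_op A) = mtrace (ptrace_dual P ** A)"
proof -
  have *: "P $ (i, j) $ (k, l) * (if l = j then A $ k $ i else 0)
      = (if l = j then P $ (i, j) $ (k, j) * A $ k $ i else 0)" for i j k l
    by simp
  have "mtrace (P ** left_op A) = (\<Sum>i\<in>UNIV. \<Sum>j\<in>UNIV. \<Sum>k\<in>UNIV. P $ (i, j) $ (k, j) * A $ k $ i)"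
    by (simp add: mtrace_def left_op_def matrix_matrix_mult_def sum_UNIV_prod * cong: if_cong)
  also have "\<dots> = mtrace (ptrace_dual P ** A)"
    unfolding mtrace_def ptrace_dual_def matrix_matrix_mult_def
    by (simp add: sum_distrib_right) (intro sum.cong refl sum.swap)
  finally show ?thesis .
qed

lemma mtrace_right_op: "mtrace (P ** right_op B) = mtrace (ptrace_H P ** B)"
proof -
  have *: "P $ (i, j) $ (k, l) * (if k = i then B $ l $ j else 0)
      = (if k = i then P $ (i, j) $ (i, l) * B $ l $ j else 0)" for i j k l
    by simp
  have "mtrace (P ** right_op B) = (\<Sum>i\<in>UNIV. \<Sum>j\<in>UNIV. \<Sum>k\<in>UNIV. \<Sum>l\<in>UNIV.
      if k = i then P $ (i, j) $ (i, l) * B $ l $ j else 0)"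
    by (simp add: mtrace_def right_op_def matrix_matrix_mult_def sum_UNIV_prod * cong: if_cong)
  also have "\<dots> = (\<Sum>i\<in>UNIV. \<Sum>j\<in>UNIV. \<Sum>l\<in>UNIV. P $ (i, j) $ (i, l) * B $ l $ j)"
    by (subst sum.swap[where A = UNIV and B = UNIV and g = "\<lambda>k l. if k = _ then _ k l else _ k l"]) simp
  also have "\<dots> = mtrace (ptrace_H P ** B)"
    unfolding mtrace_def ptrace_H_def matrix_matrix_mult_def
    by (simp add: sum_distrib_right) (subst sum.swap, intro sum.cong refl sum.swap)
  finally show ?thesis .
qed

lemma left_op_right_op_component:
  "(left_op A ** right_op B) $ x $ y = A $ fst x $ fst y * B $ snd x $ snd y"
proof -
  have "(if snd x = l then A $ fst x $ k else 0) * (if k = fst y then B $ l $ snd y else 0)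
      = (if k = fst y then if snd x = l then A $ fst x $ k * B $ l $ snd y else 0 else 0)" for k l
    by simp
  then have "(left_op A ** right_op B) $ x $ y
      = (\<Sum>l\<in>UNIV. \<Sum>k\<in>UNIV. if k = fst y then if snd x = l then A $ fst x $ k * B $ l $ snd y else 0 else 0)"
    by (simp add: left_op_def right_op_def matrix_matrix_mult_def sum_UNIV_prod cong: if_cong) (subst sum.swap, simp)
  then show ?thesis by simp
qed

text \<open>The entries agree with those of the product in the other order, which is how the two
  operators are seen to commute.\<close>

lemma right_op_left_op_component:
  "(right_op B ** left_op A) $ x $ y = A $ fst x $ fst y * B $ snd x $ snd y"
proof -
  have "(if fst x = k then B $ snd x $ l else 0) * (if l = snd y then A $ k $ fst y else 0)
      = (if l = snd y then if fst x = k then A $ k $ fst y * B $ snd x $ l else 0 else 0)" for k l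
    by simp
  then have "(right_op B ** left_op A) $ x $ y
      = (\<Sum>k\<in>UNIV. \<Sum>l\<in>UNIV. if l = snd y then if fst x = k then A $ k $ fst y * B $ snd x $ l else 0 else 0)"
    by (simp add: left_op_def right_op_def matrix_matrix_mult_def sum_UNIV_prod cong: if_cong)
  then show ?thesis by simp
qed

lemma left_op_mult: "left_op A ** left_op B = left_op (A ** B)"
proof -
  have "(if snd x = l then A $ fst x $ k else 0) * (if l = snd y then B $ k $ fst y else 0)
      = (if l = snd y then if snd x = snd y then A $ fst x $ k * B $ k $ fst y else 0 else 0)"
    for x y :: "'a \<times> 'a" and k l
    by simp
  then show ?thesis
    by (simp add: vec_eq_iff left_op_def matrix_matrix_mult_def sum_UNIV_prod cong: if_cong)
qed

lemma right_op_mult: "right_op A ** right_op B = right_op (A ** B)"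
proof -
  have "(if fst x = k then A $ snd x $ l else 0) * (if k = fst y then B $ l $ snd y else 0)
      = (if k = fst y then if fst x = fst y then A $ snd x $ l * B $ l $ snd y else 0 else 0)"
    for x y :: "'a \<times> 'a" and k l
    by simp
  then show ?thesis
    by (simp add: vec_eq_iff right_op_def matrix_matrix_mult_def sum_UNIV_prod sum.swap[of _ UNIV UNIV] cong: if_cong)
qed

lemma mtransp_mult: "mtransp A ** mtransp B = mtransp (B ** A)"
  by (simp add: mtransp_def matrix_matrix_mult_def vec_eq_iff mult.commute)

lemma mtrace_mtransp [simp]: "mtrace (mtransp A) = mtrace A"
  by (simp add: mtransp_def mtrace_def)

text \<open>The transpose on the dual factor acts as right multiplication of \<open>X k\<close> by
  \<open>A\<close>; expanded in entries, both sides are the same sum.\<close>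

lemma mtrace_left_op_right_op:
  fixes X :: "'k::finite \<Rightarrow> 'n::finite cmat"
  assumes "madj A = A"
  shows "Re (mtrace (kraus_op X ** (left_op A ** right_op (mtransp A)))) = corr A X"
proof -
  have "mtrace (madj (X k) ** (A ** (X k ** A)))
      = (\<Sum>x\<in>UNIV. \<Sum>y\<in>UNIV. X k $ fst x $ snd x * cnj (X k $ fst y $ snd y) * (A $ fst y $ fst x * A $ snd x $ snd y))" for k
  proof -
    have "mtrace (madj (X k) ** (A ** (X k ** A)))
      = (\<Sum>d\<in>UNIV. \<Sum>c\<in>UNIV. \<Sum>a\<in>UNIV. \<Sum>b\<in>UNIV.
           X k $ a $ b * cnj (X k $ c $ d) * (A $ c $ a * A $ b $ d))"
      by (simp add: mtrace_def matrix_matrix_mult_def madj_def sum_distrib_left mult_ac)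
    also have "\<dots> = (\<Sum>y\<in>UNIV. \<Sum>x\<in>UNIV. X k $ fst x $ snd x * cnj (X k $ fst y $ snd y) * (A $ fst y $ fst x * A $ snd x $ snd y))"
      by (simp add: sum_UNIV_prod) (rule sum.swap)
    also have "\<dots> = (\<Sum>x\<in>UNIV. \<Sum>y\<in>UNIV. X k $ fst x $ snd x * cnj (X k $ fst y $ snd y) * (A $ fst y $ fst x * A $ snd x $ snd y))"
      by (rule sum.swap)
    finally show ?thesis .
  qed
  moreover have "mtrace (kraus_op X ** N) = (\<Sum>x\<in>UNIV. \<Sum>y\<in>UNIV. kraus_op X $ x $ y * N $ y $ x)" for N
    by (simp add: mtrace_def matrix_matrix_mult_def)
  ultimately have "mtrace (kraus_op X ** (left_op A ** right_op (mtransp A)))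
     = (\<Sum>k\<in>UNIV. mtrace (madj (X k) ** (A ** (X k ** A))))"
    by (simp add: kraus_op_def mtransp_def
      left_op_right_op_component sum_distrib_right sum.swap[of _ _ "UNIV :: 'k set"])
  moreover have "madj (X k) ** (A ** (X k ** A)) = madj (A ** X k) ** (X k ** A)" for k
    by (simp add: madj_mult assms matrix_mul_assoc)
  ultimately show ?thesis
    by (simp add: corr_def Re_mtrace_madj_mult)
qed

text \<open>As the two one-sided operators commute, \<open>H ** H\<close> expands into two squares
  that see only the marginals and a mixed term given by \<open>corr\<close>.\<close>

lemma cost_kraus_op:
  assumes A: "madj A = A" and X: "kraus_coupling \<rho> \<omega> X"
  defines "H \<equiv> left_op A - right_op (mtransp A)"
  shows "Re (mtrace (kraus_op X ** (H ** H)))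
       = Re (mtrace (\<rho> ** (A ** A))) + Re (mtrace (\<omega> ** (A ** A))) - 2 * corr A X"
proof -
  have "right_op (mtransp A) ** left_op A = left_op A ** right_op (mtransp A)"
    by (simp add: vec_eq_iff left_op_right_op_component right_op_left_op_component)
  then have HH: "H ** H = left_op (A ** A) - left_op A ** right_op (mtransp A)
      - (left_op A ** right_op (mtransp A) - right_op (mtransp (A ** A)))"
    unfolding H_def matrix_mult_diff_left matrix_mult_diff_right left_op_mult right_op_mult mtransp_mult
    by simp
  have "mtrace (kraus_op X ** left_op (A ** A)) = mtrace (\<omega> ** (A ** A))"
    using X by (simp add: mtrace_left_op ptrace_dual_kraus_op kraus_coupling_def)
  moreover have "mtrace (kraus_op X ** right_op (mtransp (A ** A))) = mtrace (\<rho> ** (A ** A))"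
    using X by (simp add: mtrace_right_op ptrace_H_kraus_op kraus_coupling_def mtransp_mult mtrace_commute[of \<rho>])
  ultimately show ?thesis
    unfolding HH matrix_mult_diff_right mtrace_diff minus_complex.simps mtrace_left_op_right_op[OF A]
    by simp
qed

text \<open>The traces on the right are the sums of |X_k A|^2 and |A X_k|^2, so 2 <u, v> \<le> |u|^2
  + |v|^2 applies termwise. This will make every cost nonnegative.\<close>

lemma corr_le:
  assumes A: "madj A = A" and X: "kraus_coupling \<rho> \<omega> X"
  shows "2 * corr A X \<le> Re (mtrace (\<rho> ** (A ** A))) + Re (mtrace (\<omega> ** (A ** A)))"
proof -
  have 1: "Re (mtrace (\<rho> ** (A ** A))) = (\<Sum>k\<in>UNIV. (X k ** A) \<bullet> (X k ** A))"
  proof -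
    have "mtrace (\<rho> ** (A ** A)) = mtrace (A ** \<rho> ** A)"
      by (simp add: matrix_mul_assoc mtrace_commute[of "\<rho> ** A"])
    also have "A ** \<rho> ** A = (\<Sum>k\<in>UNIV. madj (X k ** A) ** (X k ** A))"
      using X by (auto simp: kraus_coupling_def matrix_mult_sum_left matrix_mult_sum_right madj_mult A matrix_mul_assoc)
    finally show ?thesis by (simp add: mtrace_sum Re_mtrace_madj_mult)
  qed
  have 2: "Re (mtrace (\<omega> ** (A ** A))) = (\<Sum>k\<in>UNIV. (A ** X k) \<bullet> (A ** X k))"
  proof -
    have "\<omega> ** (A ** A) = (\<Sum>k\<in>UNIV. X k ** madj (X k) ** A ** A)"
      using X by (auto simp: kraus_coupling_def matrix_mult_sum_left matrix_mul_assoc)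
    also have "mtrace \<dots> = (\<Sum>k\<in>UNIV. mtrace (madj (A ** X k) ** (A ** X k)))"
      unfolding mtrace_sum
      by (intro sum.cong refl) (simp add: madj_mult A matrix_mul_assoc mtrace_commute[of _ "X _"])
    finally show ?thesis by (simp add: mtrace_sum Re_mtrace_madj_mult)
  qed
  have "2 * (u \<bullet> v) \<le> v \<bullet> v + u \<bullet> u" for u v :: "'a cmat"
    using inner_ge_zero[of "u - v"] by (simp add: inner_diff inner_commute)
  then show ?thesis
    unfolding 1 2 corr_def sum_distrib_left sum.distrib[symmetric] by (intro sum_mono)
qed

section \<open>Composition of couplings\<close>

text \<open>The image of \<open>A\<close> under the completely positive map with Kraus operators
  \<open>X k\<close>.\<close>

definition push :: "'n::finite cmat \<Rightarrow> ('k::finite \<Rightarrow> 'n cmat) \<Rightarrow> 'n cmat" where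
  "push A X = (\<Sum>k\<in>UNIV. X k ** A ** madj (X k))"

text \<open>Composition of two families through a common marginal; \<open>T\<close> stands for the
  inverse square root of that marginal.\<close>

definition glue :: "'n::finite cmat \<Rightarrow> ('k \<Rightarrow> 'n cmat) \<Rightarrow> ('l \<Rightarrow> 'n cmat) \<Rightarrow> 'k \<times> 'l \<Rightarrow> 'n cmat" where
  "glue T X Y = (\<lambda>(k, l). Y l ** T ** X k)"

lemma kraus_coupling_madj:
  "kraus_coupling \<rho> \<omega> X \<Longrightarrow> kraus_coupling \<omega> \<rho> (\<lambda>k. madj (X k))"
  by (simp add: kraus_coupling_def)

text \<open>\<open>R\<close> is a square root of \<tau> and \<open>T\<close> a generalized inverse
  of it. Their product is an orthogonal projection that fixes \<tau>, which allows \<tau> to be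
  singular.\<close>

locale sqrt_pinv =
  fixes \<tau> R T :: "'n::finite cmat"
  assumes madj_R: "madj R = R" and madj_T: "madj T = T"
    and R_R: "R ** R = \<tau>" and R_T: "R ** T = T ** R" and R_T_R: "R ** T ** R = R"
begin

text \<open>The part \<open>W k\<close> of \<open>Y k\<close> off the support satisfies sum_k W_k*
  W_k = (1 - T R) \<tau> (1 - T R) = 0, so every \<open>W k\<close> is zero.\<close>

lemma support_right:
  fixes Y :: "'k::finite \<Rightarrow> 'n cmat"
  assumes "kraus_coupling \<tau> \<omega> Y"
  shows "Y k ** T ** R = Y k"
proof -
  define W where "W k = Y k - Y k ** (T ** R)" for k
  have \<tau>: "(\<Sum>k\<in>UNIV. madj (Y k) ** Y k) = \<tau>"
    using assms by (simp add: kraus_coupling_def)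
  have TRR: "T ** R ** \<tau> = \<tau>"
    using R_T_R by (simp add: R_T[symmetric] R_R[symmetric] matrix_mul_assoc)
  have "madj (W k) ** W k = madj (Y k) ** Y k - T ** R ** (madj (Y k) ** Y k)
      - (madj (Y k) ** Y k - T ** R ** (madj (Y k) ** Y k)) ** (T ** R)" for k
  proof -
    have "madj (W k) = madj (Y k) - T ** R ** madj (Y k)"
      by (simp add: W_def madj_diff madj_mult madj_R madj_T R_T)
    then show ?thesis
      by (simp add: W_def matrix_mult_diff_left matrix_mult_diff_right matrix_mul_assoc)
  qed
  then have "(\<Sum>k\<in>UNIV. madj (W k) ** W k) = \<tau> - T ** R ** \<tau> - (\<tau> - T ** R ** \<tau>) ** (T ** R)"
    by (simp only: sum_subtractf matrix_mult_sum_left[symmetric] matrix_mult_sum_right[symmetric] \<tau>)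
  also have "\<dots> = 0"
    unfolding TRR by (simp add: matrix_matrix_mult_def vec_eq_iff)
  finally have "W k = 0" by (rule sum_madj_mult_eq_0)
  then show ?thesis by (simp add: W_def matrix_mul_assoc)
qed

lemma support_left:
  fixes X :: "'k::finite \<Rightarrow> 'n cmat"
  assumes "kraus_coupling \<rho> \<tau> X"
  shows "R ** T ** X k = X k"
proof -
  have "madj (madj (X k) ** T ** R) = madj (madj (X k))"
    using support_right[OF kraus_coupling_madj[OF assms]] by simp
  then show ?thesis by (simp add: madj_mult madj_R madj_T matrix_mul_assoc)
qed

text \<open>Summing over the index of \<open>X\<close> produces \<tau> = R R between two factors
  \<open>T\<close>, and Y_l T R = Y_l leaves Y_l Y_l*.\<close>

lemma glue_range:
  fixes X :: "'k::finite \<Rightarrow> 'n cmat" and Y :: "'l::finite \<Rightarrow> 'n cmat"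
  assumes X: "kraus_coupling \<rho> \<tau> X" and Y: "kraus_coupling \<tau> \<omega> Y"
  shows "(\<Sum>z\<in>UNIV. glue T X Y z ** madj (glue T X Y z)) = \<omega>"
proof -
  have "(\<Sum>k\<in>UNIV. glue T X Y (k, l) ** madj (glue T X Y (k, l))) = Y l ** madj (Y l)" for l
  proof -
    have "(\<Sum>k\<in>UNIV. glue T X Y (k, l) ** madj (glue T X Y (k, l)))
        = (\<Sum>k\<in>UNIV. Y l ** T ** (X k ** madj (X k)) ** T ** madj (Y l))"
      by (simp add: glue_def madj_mult madj_T matrix_mul_assoc)
    also have "\<dots> = Y l ** T ** \<tau> ** T ** madj (Y l)"
      using X by (simp only: matrix_mult_sum_left[symmetric] matrix_mult_sum_right[symmetric] kraus_coupling_def)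
    also have "\<dots> = (Y l ** T ** R) ** madj (Y l ** T ** R)"
      by (simp add: madj_mult madj_T madj_R R_R[symmetric] matrix_mul_assoc)
    finally show ?thesis by (simp add: support_right[OF Y])
  qed
  then show ?thesis
    using Y by (simp add: sum_UNIV_prod sum.swap[of _ "UNIV :: 'l set" "UNIV :: 'k set"] kraus_coupling_def)
qed

lemma kraus_coupling_glue:
  fixes X :: "'k::finite \<Rightarrow> 'n cmat" and Y :: "'l::finite \<Rightarrow> 'n cmat"
  assumes X: "kraus_coupling \<rho> \<tau> X" and Y: "kraus_coupling \<tau> \<omega> Y"
  shows "kraus_coupling \<rho> \<omega> (glue T X Y)"
proof -
  \<comment> \<open>The adjoint of a glued family glues the adjoint families in reverse order, so
    \<open>glue_range\<close> also yields the other marginal after swapping the index pair.\<close>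
  have "glue T (\<lambda>l. madj (Y l)) (\<lambda>k. madj (X k)) (prod.swap z) = madj (glue T X Y z)" for z
    by (simp add: glue_def madj_mult madj_T matrix_mul_assoc split: prod.split)
  moreover have "(\<Sum>z\<in>UNIV. glue T (\<lambda>l. madj (Y l)) (\<lambda>k. madj (X k)) z ** madj (glue T (\<lambda>l. madj (Y l)) (\<lambda>k. madj (X k)) z)) = \<rho>"
    by (rule glue_range[OF kraus_coupling_madj[OF Y] kraus_coupling_madj[OF X]])
  moreover have "(\<Sum>z\<in>UNIV. f z) = (\<Sum>z\<in>UNIV. f (prod.swap z))" for f :: "'l \<times> 'k \<Rightarrow> 'n cmat"
    by (rule sum.reindex_bij_betw[symmetric]) (simp add: bij_swap)
  ultimately show ?thesis
    using glue_range[OF X Y] by (simp add: kraus_coupling_def)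
qed

text \<open>The canonical purification of \<tau>, as a family with one member; it is neutral for
  gluing.\<close>

lemma kraus_coupling_sqrt: "kraus_coupling \<tau> \<tau> (\<lambda>_::unit. R)"
  by (simp add: kraus_coupling_def madj_R R_R UNIV_unit)

text \<open>Cyclicity of the trace separates \<open>X\<close> from \<open>Y\<close>, with a factor
  \<open>T\<close> at each of the two junctions. Writing \<open>T\<close> as \<open>S ** S\<close>
  gives an inner product of one vector from \<open>X\<close> and one from \<open>Y\<close>.\<close>

lemma corr_glue:
  fixes X :: "'k::finite \<Rightarrow> 'n cmat" and Y :: "'l::finite \<Rightarrow> 'n cmat"
  assumes A: "madj A = A" and S: "madj S = S" "S ** S = T"
  shows "corr A (glue T X Y) = (S ** push A X ** S) \<bullet> (S ** push A (\<lambda>l. madj (Y l)) ** S)"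
proof -
  have "(A ** (Y l ** T ** X k)) \<bullet> (Y l ** T ** X k ** A)
      = Re (mtrace ((X k ** A ** madj (X k)) ** (T ** (madj (Y l) ** A ** Y l) ** T)))" for k l
  proof -
    have "mtrace ((X k ** A ** madj (X k)) ** (T ** (madj (Y l) ** A ** Y l) ** T))
        = mtrace ((X k ** A) ** (madj (X k) ** (T ** (madj (Y l) ** A ** Y l) ** T)))"
      by (simp add: matrix_mul_assoc)
    also have "\<dots> = mtrace ((madj (X k) ** (T ** (madj (Y l) ** A ** Y l) ** T)) ** (X k ** A))"
      by (rule mtrace_commute)
    also have "(madj (X k) ** (T ** (madj (Y l) ** A ** Y l) ** T)) ** (X k ** A)
        = madj (A ** (Y l ** T ** X k)) ** (Y l ** T ** X k ** A)"
      by (simp add: madj_mult A madj_T matrix_mul_assoc)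
    finally show ?thesis by (simp add: Re_mtrace_madj_mult)
  qed
  then have "corr A (glue T X Y)
     = Re (mtrace (\<Sum>k\<in>UNIV. \<Sum>l\<in>UNIV. (X k ** A ** madj (X k)) ** (T ** (madj (Y l) ** A ** Y l) ** T)))"
    by (simp add: corr_def glue_def sum_UNIV_prod mtrace_sum)
  also have "\<dots> = Re (mtrace (push A X ** (T ** push A (\<lambda>l. madj (Y l)) ** T)))"
    unfolding push_def by (simp add: matrix_mult_sum_left matrix_mult_sum_right sum.swap[of _ "UNIV :: 'l set" "UNIV :: 'k set"])
  also have "mtrace (push A X ** (T ** push A (\<lambda>l. madj (Y l)) ** T))
      = mtrace ((push A X ** S ** S ** push A (\<lambda>l. madj (Y l)) ** S) ** S)"
    by (simp add: S(2)[symmetric] matrix_mul_assoc)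
  also have "\<dots> = mtrace (S ** (push A X ** S ** S ** push A (\<lambda>l. madj (Y l)) ** S))"
    by (rule mtrace_commute)
  also have "S ** (push A X ** S ** S ** push A (\<lambda>l. madj (Y l)) ** S)
      = madj (S ** push A X ** S) ** (S ** push A (\<lambda>l. madj (Y l)) ** S)"
  proof -
    have "madj (push A X) = push A X"
      by (simp add: push_def madj_sum madj_mult A matrix_mul_assoc)
    then show ?thesis by (simp add: madj_mult S(1) matrix_mul_assoc)
  qed
  finally show ?thesis by (simp add: Re_mtrace_madj_mult)
qed

text \<open>Gluing with \<open>R\<close> returns the family, since R T X_k = X_k. Hence the
  correlation of \<open>X\<close> itself is an inner product with a vector that depends on \<tau>
  only.\<close>

lemma corr_glue_sqrt_right:
  fixes X :: "'k::finite \<Rightarrow> 'n cmat"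
  assumes "kraus_coupling \<rho> \<tau> X"
  shows "corr A (glue T X (\<lambda>_::unit. R)) = corr A X"
  by (simp add: corr_def glue_def sum_UNIV_prod UNIV_unit support_left[OF assms])

lemma corr_glue_sqrt_left:
  fixes Y :: "'k::finite \<Rightarrow> 'n cmat"
  assumes "kraus_coupling \<tau> \<omega> Y"
  shows "corr A (glue T (\<lambda>_::unit. R) Y) = corr A Y"
  by (simp add: corr_def glue_def sum_UNIV_prod UNIV_unit support_right[OF assms])

end

text \<open>By \<open>psd\<close>, the numbers x, y, z, p, q, r are the inner products of three
  vectors e1, e2, e3. Orthogonal additions raise the squared norms to a, b, c; the radicands are
  then squared distances.\<close>

lemma gram_triangle:
  fixes x y z a b c p q r :: real
  assumes psd: "\<And>s t u. 0 \<le> s\<^sup>2 * x + t\<^sup>2 * y + u\<^sup>2 * z + 2 * (s * t * p) + 2 * (t * u * q) + 2 * (s * u * r)"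
    and le: "x \<le> a" "y \<le> b" "z \<le> c"
  shows "0 \<le> a + b - 2 * p" "0 \<le> b + c - 2 * q"
    "sqrt (a + c - 2 * r) \<le> sqrt (a + b - 2 * p) + sqrt (b + c - 2 * q)"
proof -
  define u where "u = a + b - 2 * p"
  define v where "v = b + c - 2 * q"
  define w where "w = a + c - 2 * r"
  show u: "0 \<le> a + b - 2 * p" using psd[of 1 "-1" 0] le by simp
  show v: "0 \<le> b + c - 2 * q" using psd[of 0 1 "-1"] le by simp
  \<comment> \<open>The raised form at s (e1 - e2) + t (e2 - e3), hence the coefficients s, t - s,
    -t; \<open>w - u - v\<close> is twice the inner product of the two differences.\<close>
  have quad: "0 \<le> s\<^sup>2 * u + t\<^sup>2 * v + s * t * (w - u - v)" for s t
  proof -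
    have "s\<^sup>2 * x \<le> s\<^sup>2 * a" "(t - s)\<^sup>2 * y \<le> (t - s)\<^sup>2 * b" "t\<^sup>2 * z \<le> t\<^sup>2 * c"
      using le by (simp_all add: mult_left_mono)
    then have "0 \<le> s\<^sup>2 * a + (t - s)\<^sup>2 * b + t\<^sup>2 * c
        + 2 * (s * (t - s) * p) + 2 * ((t - s) * (- t) * q) + 2 * (s * (- t) * r)"
      using psd[of s "t - s" "- t"] by simp
    then show ?thesis
      by (simp add: u_def v_def w_def power2_eq_square algebra_simps)
  qed
  have "w \<le> (sqrt u + sqrt v)\<^sup>2"
  proof (cases "u = 0 \<or> v = 0")
    case True
    \<comment> \<open>The form is now affine in one variable, so its mixed coefficient vanishes;
      otherwise the witnesses below would give it the value -1.\<close>
    have "w - u - v = 0"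
    proof (rule ccontr)
      define k where "k = w - u - v"
      assume "w - u - v \<noteq> 0"
      then have k: "k \<noteq> 0" by (simp add: k_def)
      note quad = quad[folded k_def]
      from True show False
      proof
        assume "u = 0"
        with quad[of "- (v + 1) / k" 1] k show False by simp
      next
        assume "v = 0"
        with quad[of 1 "- (u + 1) / k"] k show False by simp
      qed
    qed
    moreover have "u + v \<le> (sqrt u + sqrt v)\<^sup>2"
      using u v unfolding u_def[symmetric] v_def[symmetric] by (simp add: power2_sum)
    ultimately show ?thesis by simp
  next
    case False
    with u v have uv: "u > 0" "v > 0" by (auto simp: u_def v_def)
    \<comment> \<open>Cauchy-Schwarz: these arguments make the two square terms both equal to u
      v.\<close>
    have "0 \<le> (sqrt u * sqrt v) * (2 * (sqrt u * sqrt v) - (w - u - v))"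
      using quad[of "sqrt v" "- sqrt u"] uv
      by (simp add: algebra_simps) (simp add: mult.assoc[symmetric])
    then have "w - u - v \<le> 2 * (sqrt u * sqrt v)"
      using uv mult_le_cancel_left_pos[of "sqrt u * sqrt v" 0 "2 * (sqrt u * sqrt v) - (w - u - v)"]
      by (metis diff_ge_0_iff_ge mult_pos_pos mult_zero_right real_sqrt_gt_0_iff)
    then show ?thesis using uv by (simp add: power2_sum)
  qed
  then have "sqrt w \<le> \<bar>sqrt u + sqrt v\<bar>"
    by (metis real_sqrt_abs real_sqrt_le_iff)
  then show "sqrt (a + c - 2 * r) \<le> sqrt (a + b - 2 * p) + sqrt (b + c - 2 * q)"
    using u v by (simp add: u_def v_def w_def)
qed

text \<open>Squaring gives (L - K)^2 + h \<le> x, a lower bound that passes to the infimum. If L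
  \<le> K, nonnegativity of the root suffices.\<close>

lemma le_sqrt_Inf_add:
  fixes S :: "real set"
  assumes ne: "S \<noteq> {}" and h: "\<And>x. x \<in> S \<Longrightarrow> h \<le> x"
    and le: "\<And>x. x \<in> S \<Longrightarrow> L \<le> sqrt (x - h) + K"
  shows "L \<le> sqrt (Inf S - h) + K"
proof (cases "L - K \<le> 0")
  case True
  have "h \<le> Inf S" using ne h by (rule cInf_greatest)
  then show ?thesis using True by (smt (verit) real_sqrt_ge_zero)
next
  case False
  have "(L - K)\<^sup>2 + h \<le> x" if "x \<in> S" for x
  proof -
    have "(L - K)\<^sup>2 \<le> (sqrt (x - h))\<^sup>2"
      using le[OF that] False by (intro power_mono) auto
    then show ?thesis using h[OF that] by simp
  qed
  then have "(L - K)\<^sup>2 + h \<le> Inf S" using ne by (intro cInf_greatest)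
  then have "L - K \<le> sqrt (Inf S - h)" by (intro real_le_rsqrt) simp
  then show ?thesis by simp
qed

text \<open>After division by the left side, this is t \<le> t^q on [0, 1] for the two fractions of
  x + y.\<close>

lemma powr_subadditive:
  fixes x y q :: real
  assumes "x \<ge> 0" "y \<ge> 0" "0 < q" "q \<le> 1"
  shows "(x + y) powr q \<le> x powr q + y powr q"
proof (cases "x + y = 0")
  case False
  with assms have s: "x + y > 0" by simp
  have le: "t \<le> t powr q" if "0 \<le> t" "t \<le> 1" for t :: real
    using powr_mono'[of q 1 t] that assms by (cases "t = 0") auto
  have "1 = x / (x + y) + y / (x + y)"
    using s by (simp flip: add_divide_distrib)
  also have "\<dots> \<le> (x / (x + y)) powr q + (y / (x + y)) powr q"
    using assms s by (intro add_mono le) auto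
  also have "\<dots> = (x powr q + y powr q) / (x + y) powr q"
    using assms s by (simp add: powr_divide add_divide_distrib)
  finally show ?thesis using s by simp
qed (use assms in auto)

section \<open>The triangle inequality\<close>

definition transport_cost :: "'n::finite cmat list \<Rightarrow> real \<Rightarrow> 'n cmat \<Rightarrow> 'n cmat \<Rightarrow> real" where
  "transport_cost As p \<rho> \<omega> = Inf {Re (mtrace (P ** cost_op As p)) | P. P \<in> couplings \<rho> \<omega>}"

text \<open>The product \<omega> (x) \<rho>^T is a coupling, with Kraus operators x_k y_l* built
  from rank-one decompositions. This keeps the infimum from being taken over the empty set.\<close>

lemma couplings_nonempty:
  fixes \<rho> \<omega> :: "'n::finite cmat"
  assumes "\<rho> \<in> states" "\<omega> \<in> states"
  shows "couplings \<rho> \<omega> \<noteq> {}"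
proof -
  obtain x :: "'n \<Rightarrow> complex^'n" where x: "\<And>i j. \<omega> $ i $ j = (\<Sum>k\<in>UNIV. x k $ i * cnj (x k $ j))"
    using positive_op_sum_rank_one assms(2) unfolding states_def by blast
  obtain y :: "'n \<Rightarrow> complex^'n" where y: "\<And>i j. \<rho> $ i $ j = (\<Sum>k\<in>UNIV. y k $ i * cnj (y k $ j))"
    using positive_op_sum_rank_one assms(1) unfolding states_def by blast
  have tr: "(\<Sum>m\<in>UNIV. \<rho> $ m $ m) = 1" "(\<Sum>m\<in>UNIV. \<omega> $ m $ m) = 1"
    using assms by (simp_all add: states_def mtrace_def)
  define X :: "'n \<times> 'n \<Rightarrow> 'n cmat" where "X = (\<lambda>(k, l). \<chi> i j. x k $ i * cnj (y l $ j))"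
  have "(\<Sum>z\<in>UNIV. X z ** madj (X z)) $ i $ j = \<omega> $ i $ j * (\<Sum>m\<in>UNIV. \<rho> $ m $ m)" for i j
  proof -
    have "(\<Sum>z\<in>UNIV. X z ** madj (X z)) $ i $ j
        = (\<Sum>k\<in>UNIV. \<Sum>l\<in>UNIV. \<Sum>m\<in>UNIV. (x k $ i * cnj (x k $ j)) * (y l $ m * cnj (y l $ m)))"
      by (simp add: X_def sum_UNIV_prod matrix_matrix_mult_def madj_def mult_ac)
    also have "\<dots> = \<omega> $ i $ j * (\<Sum>l\<in>UNIV. \<Sum>m\<in>UNIV. y l $ m * cnj (y l $ m))"
      by (simp only: sum_distrib_left[symmetric] sum_distrib_right[symmetric] x)
    also have "(\<Sum>l\<in>UNIV. \<Sum>m\<in>UNIV. y l $ m * cnj (y l $ m)) = (\<Sum>m\<in>UNIV. \<rho> $ m $ m)"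
      unfolding y by (rule sum.swap)
    finally show ?thesis .
  qed
  moreover have "(\<Sum>z\<in>UNIV. madj (X z) ** X z) $ i $ j = (\<Sum>m\<in>UNIV. \<omega> $ m $ m) * \<rho> $ i $ j" for i j
  proof -
    have "(\<Sum>z\<in>UNIV. madj (X z) ** X z) $ i $ j
        = (\<Sum>k\<in>UNIV. \<Sum>l\<in>UNIV. \<Sum>m\<in>UNIV. (y l $ i * cnj (y l $ j)) * (x k $ m * cnj (x k $ m)))"
      by (simp add: X_def sum_UNIV_prod matrix_matrix_mult_def madj_def mult_ac)
    also have "\<dots> = (\<Sum>k\<in>UNIV. \<rho> $ i $ j * (\<Sum>m\<in>UNIV. x k $ m * cnj (x k $ m)))"
      by (simp only: sum_distrib_left[symmetric] sum_distrib_right[symmetric] y)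
    also have "\<dots> = (\<Sum>k\<in>UNIV. \<Sum>m\<in>UNIV. x k $ m * cnj (x k $ m)) * \<rho> $ i $ j"
      by (simp only: sum_distrib_left[symmetric] mult.commute)
    also have "(\<Sum>k\<in>UNIV. \<Sum>m\<in>UNIV. x k $ m * cnj (x k $ m)) = (\<Sum>m\<in>UNIV. \<omega> $ m $ m)"
      unfolding x by (rule sum.swap)
    finally show ?thesis .
  qed
  ultimately have "kraus_coupling \<rho> \<omega> X"
    by (simp add: kraus_coupling_def vec_eq_iff[of "sum _ _"] tr vec_eq_iff[of "sum _ _ $ _"])
  then show ?thesis
    using kraus_op_in_couplings assms(2) unfolding states_def by blast
qed

text \<open>The cost operator is a weighted sum of squares. The dimension is arbitrary here; qubits
  supply the weights through \<open>abs_pow_commutator_op\<close>.\<close>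

locale quadratic_cost =
  fixes As :: "'n::finite cmat list" and p :: real and w :: "'n cmat \<Rightarrow> real"
  assumes madj_obs: "A \<in> set As \<Longrightarrow> madj A = A"
    and w_nonneg: "0 \<le> w A"
    and abs_pow_obs: "A \<in> set As \<Longrightarrow> abs_pow (left_op A - right_op (mtransp A)) p
      = w A *\<^sub>R ((left_op A - right_op (mtransp A)) ** (left_op A - right_op (mtransp A)))"
begin

definition energy :: "'n cmat \<Rightarrow> real" where
  "energy \<rho> = (\<Sum>A\<leftarrow>As. w A * Re (mtrace (\<rho> ** (A ** A))))"

definition wcorr :: "('k::finite \<Rightarrow> 'n cmat) \<Rightarrow> real" where
  "wcorr X = (\<Sum>A\<leftarrow>As. w A * corr A X)"

lemma cost_eq:
  fixes X :: "'k::finite \<Rightarrow> 'n cmat"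
  assumes X: "kraus_coupling \<rho> \<omega> X"
  shows "Re (mtrace (kraus_op X ** cost_op As p)) = energy \<rho> + energy \<omega> - 2 * wcorr X"
proof -
  \<comment> \<open>\<open>As\<close> is fixed by the locale, so the induction runs over a list
    \<open>Bs\<close> whose members are observables of \<open>As\<close>.\<close>
  have "Re (mtrace (kraus_op X ** (\<Sum>A\<leftarrow>Bs. abs_pow (left_op A - right_op (mtransp A)) p)))
      = (\<Sum>A\<leftarrow>Bs. w A * Re (mtrace (\<rho> ** (A ** A)))) + (\<Sum>A\<leftarrow>Bs. w A * Re (mtrace (\<omega> ** (A ** A))))
        - 2 * (\<Sum>A\<leftarrow>Bs. w A * corr A X)" if "set Bs \<subseteq> set As" for Bs
    using that
  proof (induction Bs)
    case Nil
    then show ?case by (simp add: mtrace_def matrix_matrix_mult_def)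
  next
    case (Cons A Bs)
    let ?H = "left_op A - right_op (mtransp A)"
    have "kraus_op X ** (w A *\<^sub>R (?H ** ?H)) = w A *\<^sub>R (kraus_op X ** (?H ** ?H))"
      by (simp add: matrix_matrix_mult_def[of "kraus_op X"] vec_eq_iff scaleR_sum_right)
    then have "Re (mtrace (kraus_op X ** abs_pow ?H p)) = w A * Re (mtrace (kraus_op X ** (?H ** ?H)))"
      using Cons.prems by (simp add: abs_pow_obs mtrace_scaleR)
    also have "\<dots> = w A * (Re (mtrace (\<rho> ** (A ** A))) + Re (mtrace (\<omega> ** (A ** A))) - 2 * corr A X)"
      using cost_kraus_op[OF madj_obs X, of A] Cons.prems by simp
    finally show ?case
      using Cons by (simp add: matrix_add_ldistrib mtrace_add) (simp add: algebra_simps)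
  qed
  then show ?thesis by (simp add: cost_op_def energy_def wcorr_def)
qed

lemma two_wcorr_le:
  fixes X :: "'k::finite \<Rightarrow> 'n cmat"
  assumes X: "kraus_coupling \<rho> \<omega> X"
  shows "2 * wcorr X \<le> energy \<rho> + energy \<omega>"
proof -
  have "(\<Sum>A\<leftarrow>As. w A * (2 * corr A X))
      \<le> (\<Sum>A\<leftarrow>As. w A * (Re (mtrace (\<rho> ** (A ** A))) + Re (mtrace (\<omega> ** (A ** A)))))"
    by (intro sum_list_mono mult_left_mono w_nonneg corr_le[OF madj_obs X])
  then show ?thesis
    by (simp add: wcorr_def energy_def sum_list_addf distrib_left mult.left_commute[of _ 2] sum_list_const_mult)
qed

lemma cost_couplings_nonneg:
  assumes "P \<in> couplings \<rho> \<omega>"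
  shows "0 \<le> Re (mtrace (P ** cost_op As p))"
  using couplings_imp_kraus[OF assms] cost_eq two_wcorr_le by (metis diff_ge_0_iff_ge)

lemma transport_cost_nonneg:
  assumes "\<rho> \<in> states" "\<omega> \<in> states"
  shows "0 \<le> transport_cost As p \<rho> \<omega>"
  unfolding transport_cost_def using couplings_nonempty[OF assms] cost_couplings_nonneg
  by (intro cInf_greatest) auto

text \<open>The index type is arbitrary, so the bound covers glued families, which are indexed by
  pairs.\<close>

lemma transport_cost_le:
  fixes X :: "'k::finite \<Rightarrow> 'n cmat"
  assumes "kraus_coupling \<rho> \<omega> X" "\<omega> \<in> states"
  shows "transport_cost As p \<rho> \<omega> \<le> energy \<rho> + energy \<omega> - 2 * wcorr X"
  unfolding transport_cost_def cost_eq[OF assms(1), symmetric]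
proof (rule cInf_lower)
  show "bdd_below {Re (mtrace (P ** cost_op As p)) | P. P \<in> couplings \<rho> \<omega>}"
    using cost_couplings_nonneg by (intro bdd_belowI[of _ 0]) auto
  show "Re (mtrace (kraus_op X ** cost_op As p)) \<in> {Re (mtrace (P ** cost_op As p)) | P. P \<in> couplings \<rho> \<omega>}"
    using kraus_op_in_couplings[OF assms(1)] assms(2) by (auto simp: states_def)
qed

text \<open>Each observable gives vectors V, M, U from \<open>X\<close>, \<tau> and
  \<open>Y\<close>. Their weighted inner products are correlations of glued families, and
  \<open>gram_triangle\<close> applies to them.\<close>

lemma kraus_triangle:
  fixes X :: "'k::finite \<Rightarrow> 'n cmat" and Y :: "'l::finite \<Rightarrow> 'n cmat"
  assumes "sqrt_pinv \<tau> R T" and S: "madj S = S" "S ** S = T"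
    and st: "\<rho> \<in> states" "\<tau> \<in> states" "\<omega> \<in> states"
    and X: "kraus_coupling \<rho> \<tau> X" and Y: "kraus_coupling \<tau> \<omega> Y"
  defines "a \<equiv> transport_cost As p \<rho> \<rho> / 2" and "b \<equiv> transport_cost As p \<tau> \<tau> / 2"
    and "c \<equiv> transport_cost As p \<omega> \<omega> / 2"
    and "u \<equiv> energy \<rho> + energy \<tau> - 2 * wcorr X" and "v \<equiv> energy \<tau> + energy \<omega> - 2 * wcorr Y"
  shows "a + b \<le> u" "b + c \<le> v"
    "sqrt (transport_cost As p \<rho> \<omega> - a - c) \<le> sqrt (u - a - b) + sqrt (v - b - c)"
proof -
  interpret sqrt_pinv \<tau> R T by fact
  define X' where "X' k = madj (X k)" for k
  define Y' where "Y' l = madj (Y l)" for l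
  define R' where "R' = (\<lambda>_::unit. R)"
  have X': "kraus_coupling \<tau> \<rho> X'" and Y': "kraus_coupling \<omega> \<tau> Y'"
    using kraus_coupling_madj[OF X] kraus_coupling_madj[OF Y] by (simp_all add: X'_def[abs_def] Y'_def[abs_def])
  have R': "kraus_coupling \<tau> \<tau> R'"
    unfolding R'_def by (rule kraus_coupling_sqrt)
  define V where "V A = S ** push A X ** S" for A
  define M where "M A = S ** push A R' ** S" for A
  define U where "U A = S ** push A Y' ** S" for A
  have VU: "wcorr (glue T X Y) = (\<Sum>A\<leftarrow>As. w A * (V A \<bullet> U A))"
    and VV: "wcorr (glue T X X') = (\<Sum>A\<leftarrow>As. w A * (V A \<bullet> V A))"
    and UU: "wcorr (glue T Y' Y) = (\<Sum>A\<leftarrow>As. w A * (U A \<bullet> U A))"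
    and MM: "wcorr (glue T R' R') = (\<Sum>A\<leftarrow>As. w A * (M A \<bullet> M A))"
    and VM: "wcorr (glue T X R') = (\<Sum>A\<leftarrow>As. w A * (V A \<bullet> M A))"
    and MU: "wcorr (glue T R' Y) = (\<Sum>A\<leftarrow>As. w A * (M A \<bullet> U A))"
    unfolding wcorr_def V_def M_def U_def
    by (rule arg_cong[of _ _ sum_list], rule map_cong[OF refl],
        simp add: corr_glue[OF madj_obs S] X'_def[abs_def] Y'_def[abs_def] R'_def madj_R)+
  have VM': "wcorr (glue T X R') = wcorr X" and MU': "wcorr (glue T R' Y) = wcorr Y"
    by (simp_all add: wcorr_def R'_def corr_glue_sqrt_right[OF X] corr_glue_sqrt_left[OF Y])
  have psd: "0 \<le> s\<^sup>2 * wcorr (glue T X X') + t\<^sup>2 * wcorr (glue T R' R') + e\<^sup>2 * wcorr (glue T Y' Y)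
      + 2 * (s * t * wcorr X) + 2 * (t * e * wcorr Y) + 2 * (s * e * wcorr (glue T X Y))" for s t e
  proof -
    have "0 \<le> (\<Sum>A\<leftarrow>As. w A * ((s *\<^sub>R V A + t *\<^sub>R M A + e *\<^sub>R U A) \<bullet> (s *\<^sub>R V A + t *\<^sub>R M A + e *\<^sub>R U A)))"
      by (intro sum_list_nonneg) (auto intro!: mult_nonneg_nonneg w_nonneg)
    also have "\<dots> = (\<Sum>A\<leftarrow>As. s\<^sup>2 * (w A * (V A \<bullet> V A)) + t\<^sup>2 * (w A * (M A \<bullet> M A)) + e\<^sup>2 * (w A * (U A \<bullet> U A))
      + 2 * (s * t * (w A * (V A \<bullet> M A))) + 2 * (t * e * (w A * (M A \<bullet> U A))) + 2 * (s * e * (w A * (V A \<bullet> U A))))"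
      by (intro arg_cong[of _ _ sum_list] map_cong refl)
        (simp add: inner_add_left inner_add_right inner_commute power2_eq_square algebra_simps)
    finally show ?thesis
      by (simp add: VV MM UU VM'[symmetric] MU'[symmetric] VM MU VU sum_list_addf sum_list_const_mult)
  qed
  \<comment> \<open>The squared norms are correlations of self-couplings, obtained by gluing a
    family to its adjoint; the optimal self-costs therefore bound them from above.\<close>
  have le: "wcorr (glue T X X') \<le> energy \<rho> - a" "wcorr (glue T R' R') \<le> energy \<tau> - b"
    "wcorr (glue T Y' Y) \<le> energy \<omega> - c"
    using transport_cost_le[OF kraus_coupling_glue[OF X X'] st(1)] transport_cost_le[OF kraus_coupling_glue[OF R' R'] st(2)]
      transport_cost_le[OF kraus_coupling_glue[OF Y' Y] st(3)]
    by (simp_all add: a_def b_def c_def)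
  note gram = gram_triangle[OF psd le]
  show "a + b \<le> u" "b + c \<le> v" using gram(1,2) by (simp_all add: u_def v_def)
  \<comment> \<open>The glued family is one competitor in the infimum for \<rho> and
    \<omega>.\<close>
  have "sqrt (transport_cost As p \<rho> \<omega> - a - c)
      \<le> sqrt ((energy \<rho> - a) + (energy \<omega> - c) - 2 * wcorr (glue T X Y))"
    using transport_cost_le[OF kraus_coupling_glue[OF X Y] st(3)] by (intro real_sqrt_le_mono) simp
  also note gram(3)
  also have "energy \<rho> - a + (energy \<tau> - b) - 2 * wcorr X = u - a - b" by (simp add: u_def)
  also have "energy \<tau> - b + (energy \<omega> - c) - 2 * wcorr Y = v - b - c" by (simp add: v_def)
  finally show "sqrt (transport_cost As p \<rho> \<omega> - a - c) \<le> sqrt (u - a - b) + sqrt (v - b - c)" .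
qed

lemma transport_cost_triangle:
  assumes "sqrt_pinv \<tau> R T" and S: "madj S = S" "S ** S = T"
    and st: "\<rho> \<in> states" "\<tau> \<in> states" "\<omega> \<in> states"
  defines "a \<equiv> transport_cost As p \<rho> \<rho> / 2" and "b \<equiv> transport_cost As p \<tau> \<tau> / 2"
    and "c \<equiv> transport_cost As p \<omega> \<omega> / 2"
  shows "a + b \<le> transport_cost As p \<rho> \<tau>"
    "sqrt (transport_cost As p \<rho> \<omega> - a - c)
      \<le> sqrt (transport_cost As p \<rho> \<tau> - a - b) + sqrt (transport_cost As p \<tau> \<omega> - b - c)"
proof -
  let ?S = "\<lambda>\<rho> \<omega>. {Re (mtrace (P ** cost_op As p)) | P. P \<in> couplings \<rho> \<omega>}"
  have ne: "?S \<rho> \<tau> \<noteq> {}" "?S \<tau> \<omega> \<noteq> {}"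
    using couplings_nonempty st by auto
  have tri: "a + b \<le> x" "b + c \<le> y"
    "sqrt (transport_cost As p \<rho> \<omega> - a - c) \<le> sqrt (x - (a + b)) + sqrt (y - (b + c))"
    if x: "x \<in> ?S \<rho> \<tau>" and y: "y \<in> ?S \<tau> \<omega>" for x y
  proof -
    obtain X :: "'n \<times> 'n \<Rightarrow> 'n cmat" where X: "x = energy \<rho> + energy \<tau> - 2 * wcorr X" "kraus_coupling \<rho> \<tau> X"
      using x cost_eq by (auto elim!: couplings_imp_kraus)
    obtain Y :: "'n \<times> 'n \<Rightarrow> 'n cmat" where Y: "y = energy \<tau> + energy \<omega> - 2 * wcorr Y" "kraus_coupling \<tau> \<omega> Y"
      using y cost_eq by (auto elim!: couplings_imp_kraus)
    show "a + b \<le> x" "b + c \<le> y"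
      "sqrt (transport_cost As p \<rho> \<omega> - a - c) \<le> sqrt (x - (a + b)) + sqrt (y - (b + c))"
      using kraus_triangle[OF assms(1-3) st X(2) Y(2)]
      unfolding X(1) Y(1) a_def b_def c_def by (simp_all add: diff_diff_eq add.assoc)
  qed
  \<comment> \<open>\<open>tri\<close> speaks of pairs of costs, so bounds on one member need some
    value for the other.\<close>
  obtain x0 y0 where 0: "x0 \<in> ?S \<rho> \<tau>" "y0 \<in> ?S \<tau> \<omega>" using ne by auto
  show "a + b \<le> transport_cost As p \<rho> \<tau>"
    unfolding transport_cost_def using ne(1) tri(1)[OF _ 0(2)] by (rule cInf_greatest)
  let ?L = "sqrt (transport_cost As p \<rho> \<omega> - a - c)"
  \<comment> \<open>The infimum is taken over the first pair of states with \<open>y\<close> fixed,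
    then over the second.\<close>
  have "?L \<le> sqrt (Inf (?S \<rho> \<tau>) - (a + b)) + sqrt (y - (b + c))" if "y \<in> ?S \<tau> \<omega>" for y
    using ne(1) tri(1)[OF _ that] tri(3)[OF _ that] by (rule le_sqrt_Inf_add)
  then have "?L \<le> sqrt (y - (b + c)) + sqrt (Inf (?S \<rho> \<tau>) - (a + b))" if "y \<in> ?S \<tau> \<omega>" for y
    using that by (simp add: add.commute)
  with ne(2) tri(2)[OF 0(1)]
  have "?L \<le> sqrt (Inf (?S \<tau> \<omega>) - (b + c)) + sqrt (Inf (?S \<rho> \<tau>) - (a + b))"
    by (rule le_sqrt_Inf_add)
  then show "?L \<le> sqrt (transport_cost As p \<rho> \<tau> - a - b) + sqrt (transport_cost As p \<tau> \<omega> - b - c)"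
    by (simp add: transport_cost_def diff_diff_eq add.commute)
qed

text \<open>Where the base is nonnegative, the power 1/p is the power 2/p of the square root, and
  square roots are what obey the Hilbert space triangle inequality.\<close>

lemma wdiv_eq:
  assumes p: "p \<ge> 2" and st: "\<rho> \<in> states" "\<omega> \<in> states"
    and nonneg: "transport_cost As p \<rho> \<rho> / 2 + transport_cost As p \<omega> \<omega> / 2 \<le> transport_cost As p \<rho> \<omega>"
  shows "wdiv As p \<rho> \<omega>
    = sqrt (transport_cost As p \<rho> \<omega> - transport_cost As p \<rho> \<rho> / 2 - transport_cost As p \<omega> \<omega> / 2) powr (2 / p)"
proof -
  have "wdist As p \<rho>' \<omega>' powr p = transport_cost As p \<rho>' \<omega>'"
    if "\<rho>' \<in> states" "\<omega>' \<in> states" for \<rho>' \<omega>'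
    using p transport_cost_nonneg[OF that]
    by (simp add: wdist_def transport_cost_def[symmetric] powr_powr min_def divide_le_eq)
  moreover have "max p 1 = p" "min (1 / p) 1 = 1 / p" using p by (auto simp: min_def divide_le_eq)
  ultimately have wdiv: "wdiv As p \<rho> \<omega>
      = (transport_cost As p \<rho> \<omega> - transport_cost As p \<rho> \<rho> / 2 - transport_cost As p \<omega> \<omega> / 2) powr (1 / p)"
    using st by (simp add: wdiv_def diff_diff_eq add_divide_distrib)
  have sqrt_powr: "x powr (1 / p) = sqrt x powr (2 / p)" if "0 \<le> x" for x
    using that by (simp add: powr_half_sqrt[symmetric] powr_powr)
  show ?thesis
    unfolding wdiv by (rule sqrt_powr) (use nonneg in simp)
qed

end

lemma ex_sqrt_pinv_2:
  fixes \<tau> :: "2 cmat"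
  assumes "\<tau> \<in> states"
  obtains R S where "sqrt_pinv \<tau> R (S ** S)" "madj S = S"
proof -
  have pos: "positive_op \<tau>" using assms by (simp add: states_def)
  have "self_adjoint \<tau>"
    using positive_op_hermitian[OF pos, symmetric] by (simp add: self_adjoint_def madj_def vec_eq_iff)
  then obtain U d where "unitary_mat U" "\<tau> = U ** diag_mat (\<lambda>i. complex_of_real (d i)) ** madj U"
    using spectral_decomposition_2 by blast
  from ex_sqrt_pinv[OF this pos] obtain R S where
    "madj R = R" "madj S = S" "R ** R = \<tau>" "R ** (S ** S) = S ** S ** R" "R ** (S ** S) ** R = R"
    by blast
  then show ?thesis
    by (intro that[of R S]) (simp_all add: sqrt_pinv_def madj_mult)
qed

theorem theorem6p2:
  fixes As :: "2 cmat list" and p :: real and \<rho> \<tau> \<omega> :: "2 cmat"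
  assumes "\<forall>A\<in>set As. self_adjoint A"
    and "p \<ge> 2"
    and "\<rho> \<in> states" and "\<tau> \<in> states" and "\<omega> \<in> states"
  shows "wdiv As p \<rho> \<omega> \<le> wdiv As p \<rho> \<tau> + wdiv As p \<tau> \<omega>"
proof -
  \<comment> \<open>Guarding the equation by membership lets one nonnegative weight function be
    chosen on all matrices, as the locale requires.\<close>
  have "\<exists>w. 0 \<le> w \<and> (A \<in> set As \<longrightarrow> abs_pow (left_op A - right_op (mtransp A)) p
      = w *\<^sub>R ((left_op A - right_op (mtransp A)) ** (left_op A - right_op (mtransp A))))" for A
    using abs_pow_commutator_op[of A p] assms(1) by (cases "A \<in> set As") auto
  then obtain w where w: "\<And>A. 0 \<le> w A" "\<And>A. A \<in> set As \<Longrightarrow> abs_pow (left_op A - right_op (mtransp A)) p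
      = w A *\<^sub>R ((left_op A - right_op (mtransp A)) ** (left_op A - right_op (mtransp A)))"
    by metis
  interpret quadratic_cost As p w
    using assms(1) w by unfold_locales (auto simp: self_adjoint_def)
  have wdiv: "wdiv As p \<rho>' \<omega>' = sqrt (transport_cost As p \<rho>' \<omega>'
      - transport_cost As p \<rho>' \<rho>' / 2 - transport_cost As p \<omega>' \<omega>' / 2) powr (2 / p)"
    and nonneg: "0 \<le> transport_cost As p \<rho>' \<omega>' - transport_cost As p \<rho>' \<rho>' / 2 - transport_cost As p \<omega>' \<omega>' / 2"
    if st: "\<rho>' \<in> states" "\<omega>' \<in> states" for \<rho>' \<omega>'
  proof -
    obtain R S where "sqrt_pinv \<omega>' R (S ** S)" "madj S = S"
      using ex_sqrt_pinv_2[OF st(2)] .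
    \<comment> \<open>Here \<omega>' serves both as the middle and as the last state.\<close>
    from transport_cost_triangle(1)[OF this refl st st(2)]
    have le: "transport_cost As p \<rho>' \<rho>' / 2 + transport_cost As p \<omega>' \<omega>' / 2 \<le> transport_cost As p \<rho>' \<omega>'" .
    then show "0 \<le> transport_cost As p \<rho>' \<omega>' - transport_cost As p \<rho>' \<rho>' / 2 - transport_cost As p \<omega>' \<omega>' / 2"
      by simp
    from wdiv_eq[OF assms(2) st le]
    show "wdiv As p \<rho>' \<omega>' = sqrt (transport_cost As p \<rho>' \<omega>'
      - transport_cost As p \<rho>' \<rho>' / 2 - transport_cost As p \<omega>' \<omega>' / 2) powr (2 / p)" .
  qed
  let ?D = "\<lambda>\<rho> \<omega>. sqrt (transport_cost As p \<rho> \<omega> - transport_cost As p \<rho> \<rho> / 2 - transport_cost As p \<omega> \<omega> / 2)"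
  obtain R S where "sqrt_pinv \<tau> R (S ** S)" "madj S = S"
    using ex_sqrt_pinv_2[OF assms(4)] .
  from transport_cost_triangle(2)[OF this refl assms(3-5)]
  have "?D \<rho> \<omega> powr (2 / p) \<le> (?D \<rho> \<tau> + ?D \<tau> \<omega>) powr (2 / p)"
    using assms(2) nonneg[OF assms(3,5)] by (intro powr_mono2) auto
  \<comment> \<open>From \<open>p \<ge> 2\<close> the exponent 2/p lies in (0, 1], where powers are
    subadditive.\<close>
  also have "\<dots> \<le> ?D \<rho> \<tau> powr (2 / p) + ?D \<tau> \<omega> powr (2 / p)"
    using assms(2) nonneg[OF assms(3,4)] nonneg[OF assms(4,5)] by (intro powr_subadditive) auto
  finally show ?thesis by (simp only: wdiv assms(3-5))
qed

end
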